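(* The functor $\mathrm{vN}$ preserves finite products. More precisely, let $I$ be a finite set and $\{A_i: i\in I\}$ any family of $\mathcal{C}^{\infty}$-rings. Then the homomorphism $\prod_{i\in I}\eta_{A_i}:\prod_{i\in I}A_i\to\prod_{i\in I}\mathrm{vN}(A_i)$ satisfies the universal property of the von Neumann regular hull of $\prod_{i\in I}A_i$; thus it is isomorphic to the arrow $\eta_{\prod_{i\in I}A_i}:\prod_{i\in I}A_i\to\mathrm{vN}(\prod_{i\in I}A_i)$, through the canonical pair of mutually inverse isomorphisms $\mathrm{vN}(\prod_{i\in I}A_i)\rightleftarrows\prod_{i\in I}\mathrm{vN}(A_i)$, where the map from left to right has components $\mathrm{vN}(\pi_j)$, with $\pi_j:\prod_{i\in I}A_i\twoheadrightarrow A_j$ the projections.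
   Context: A $\mathcal{C}^{\infty}$-ring is a set $A$ with an operation $A^n\to A$ for each $n\ge 0$ and each smooth $f:\mathbb{R}^n\to\mathbb{R}$, such that coordinate projections are interpreted as projections and composition of smooth functions is respected; $\mathcal{C}^{\infty}$-homomorphisms preserve all these operations. Each $\mathcal{C}^{\infty}$-ring has an underlying commutative unital ring. $A$ is von Neumann regular if $(\forall a\in A)(\exists x\in A)(a=a^2x)$. The von Neumann regular hull of a $\mathcal{C}^{\infty}$-ring $A$ is a von Neumann regular $\mathcal{C}^{\infty}$-ring $\mathrm{vN}(A)$ with a $\mathcal{C}^{\infty}$-homomorphism $\eta_A:A\to\mathrm{vN}(A)$ such that every $\mathcal{C}^{\infty}$-homomorphism from $A$ to a von Neumann regular $\mathcal{C}^{\infty}$-ring factors uniquely through $\eta_A$. Every $\mathcal{C}^{\infty}$-ring has such a hull, and $\mathrm{vN}$ is the left adjoint of the inclusion of the full subcategory of von Neumann regular $\mathcal{C}^{\infty}$-rings into all $\mathcal{C}^{\infty}$-rings, with unit $\eta$. *)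

theory Defs
  imports "HOL-Analysis.Analysis" "HOL-Algebra.Ring"
begin

section \<open>Smooth functions of n real variables\<close>

text \<open>
  The arity of a smooth function has to be quantified over, so it cannot be a type. The space of
  n-tuples of real numbers is the set of extensional functions on {..<n}, with the
  topology induced by the product topology, and functions on it are extensional as well, so that
  one smooth function has exactly one representation.
\<close>

definition euclid :: "nat \<Rightarrow> (nat \<Rightarrow> real) set" where
  "euclid n = {..<n} \<rightarrow>\<^sub>E UNIV"

definition partial_deriv :: "nat \<Rightarrow> nat \<Rightarrow> ((nat \<Rightarrow> real) \<Rightarrow> real) \<Rightarrow> (nat \<Rightarrow> real) \<Rightarrow> real" where
  "partial_deriv n i f = (\<lambda>x\<in>euclid n. deriv (\<lambda>t. f (x(i := t))) (x i))"

primrec C_diff :: "nat \<Rightarrow> nat \<Rightarrow> ((nat \<Rightarrow> real) \<Rightarrow> real) \<Rightarrow> bool" where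
  "C_diff n 0 = (\<lambda>f. continuous_on (euclid n) f)"
| "C_diff n (Suc k) = (\<lambda>f. continuous_on (euclid n) f \<and>
     (\<forall>i<n. (\<forall>x\<in>euclid n. (\<lambda>t. f (x(i := t))) field_differentiable at (x i)) \<and>
            C_diff n k (partial_deriv n i f)))"

definition smooth :: "nat \<Rightarrow> ((nat \<Rightarrow> real) \<Rightarrow> real) set" where
  "smooth n = {f \<in> extensional (euclid n). \<forall>k. C_diff n k f}"

definition coord :: "nat \<Rightarrow> nat \<Rightarrow> (nat \<Rightarrow> real) \<Rightarrow> real" where
  "coord n i = (\<lambda>x\<in>euclid n. x i)"

definition comp_smooth ::
    "nat \<Rightarrow> nat \<Rightarrow> ((nat \<Rightarrow> real) \<Rightarrow> real) \<Rightarrow> (nat \<Rightarrow> (nat \<Rightarrow> real) \<Rightarrow> real) \<Rightarrow> (nat \<Rightarrow> real) \<Rightarrow> real" where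
  "comp_smooth n m f g = (\<lambda>x\<in>euclid n. f (\<lambda>j\<in>{..<m}. g j x))"

definition add_smooth :: "nat \<Rightarrow> ((nat \<Rightarrow> real) \<Rightarrow> real) \<Rightarrow> ((nat \<Rightarrow> real) \<Rightarrow> real) \<Rightarrow> (nat \<Rightarrow> real) \<Rightarrow> real" where
  "add_smooth n f g = (\<lambda>x\<in>euclid n. f x + g x)"

definition mult_smooth :: "nat \<Rightarrow> ((nat \<Rightarrow> real) \<Rightarrow> real) \<Rightarrow> ((nat \<Rightarrow> real) \<Rightarrow> real) \<Rightarrow> (nat \<Rightarrow> real) \<Rightarrow> real" where
  "mult_smooth n f g = (\<lambda>x\<in>euclid n. f x * g x)"

definition const_smooth :: "nat \<Rightarrow> real \<Rightarrow> (nat \<Rightarrow> real) \<Rightarrow> real" where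
  "const_smooth n c = (\<lambda>x\<in>euclid n. c)"


section \<open>C-infinity rings\<close>

record 'a cinf = "'a partial_object" +
  opn :: "nat \<Rightarrow> ((nat \<Rightarrow> real) \<Rightarrow> real) \<Rightarrow> (nat \<Rightarrow> 'a) \<Rightarrow> 'a"

definition tuples :: "'a cinf \<Rightarrow> nat \<Rightarrow> (nat \<Rightarrow> 'a) set" where
  "tuples A n = {..<n} \<rightarrow>\<^sub>E carrier A"

definition cinf_ring :: "'a cinf \<Rightarrow> bool" where
  "cinf_ring A \<longleftrightarrow>
     (\<forall>n. \<forall>f\<in>smooth n. \<forall>a\<in>tuples A n. opn A n f a \<in> carrier A) \<and>
     (\<forall>n. \<forall>i<n. \<forall>a\<in>tuples A n. opn A n (coord n i) a = a i) \<and>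
     (\<forall>n m. \<forall>f\<in>smooth m. \<forall>g. (\<forall>j<m. g j \<in> smooth n) \<longrightarrow>
        (\<forall>a\<in>tuples A n.
           opn A n (comp_smooth n m f g) a = opn A m f (\<lambda>j\<in>{..<m}. opn A n (g j) a)))"

text \<open>Homomorphisms are extensional, so that equality of homomorphisms is equality of functions.\<close>

definition cinf_hom :: "'a cinf \<Rightarrow> 'b cinf \<Rightarrow> ('a \<Rightarrow> 'b) set" where
  "cinf_hom A B = {h \<in> carrier A \<rightarrow>\<^sub>E carrier B.
     \<forall>n. \<forall>f\<in>smooth n. \<forall>a\<in>tuples A n. h (opn A n f a) = opn B n f (\<lambda>j\<in>{..<n}. h (a j))}"

definition pair :: "'a \<Rightarrow> 'a \<Rightarrow> nat \<Rightarrow> 'a" where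
  "pair a b = (\<lambda>j\<in>{..<2}. if j = 0 then a else b)"

definition underlying_ring :: "'a cinf \<Rightarrow> 'a ring" where
  "underlying_ring A =
     \<lparr> carrier = carrier A,
       mult = (\<lambda>a b. opn A 2 (mult_smooth 2 (coord 2 0) (coord 2 1)) (pair a b)),
       one = opn A 0 (const_smooth 0 1) (\<lambda>_. undefined),
       zero = opn A 0 (const_smooth 0 0) (\<lambda>_. undefined),
       add = (\<lambda>a b. opn A 2 (add_smooth 2 (coord 2 0) (coord 2 1)) (pair a b)) \<rparr>"

definition von_neumann_regular :: "'a ring \<Rightarrow> bool" where
  "von_neumann_regular R \<longleftrightarrow>
     (\<forall>a\<in>carrier R. \<exists>x\<in>carrier R. a = a [^]\<^bsub>R\<^esub> (2::nat) \<otimes>\<^bsub>R\<^esub> x)"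

definition vn_regular_cinf_ring :: "'a cinf \<Rightarrow> bool" where
  "vn_regular_cinf_ring A \<longleftrightarrow> cinf_ring A \<and> von_neumann_regular (underlying_ring A)"


section \<open>Products\<close>

definition cinf_prod :: "'i set \<Rightarrow> ('i \<Rightarrow> 'a cinf) \<Rightarrow> ('i \<Rightarrow> 'a) cinf" where
  "cinf_prod I A =
     \<lparr> carrier = (\<Pi>\<^sub>E i\<in>I. carrier (A i)),
       opn = (\<lambda>n f a. \<lambda>i\<in>I. opn (A i) n f (\<lambda>j\<in>{..<n}. a j i)) \<rparr>"

definition cinf_proj :: "'i set \<Rightarrow> ('i \<Rightarrow> 'a cinf) \<Rightarrow> 'i \<Rightarrow> ('i \<Rightarrow> 'a) \<Rightarrow> 'a" where
  "cinf_proj I A i = (\<lambda>x\<in>carrier (cinf_prod I A). x i)"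

definition prod_map :: "'i set \<Rightarrow> ('i \<Rightarrow> 'a cinf) \<Rightarrow> ('i \<Rightarrow> 'a \<Rightarrow> 'b) \<Rightarrow> ('i \<Rightarrow> 'a) \<Rightarrow> 'i \<Rightarrow> 'b" where
  "prod_map I A h = (\<lambda>x\<in>carrier (cinf_prod I A). \<lambda>i\<in>I. h i (x i))"

definition tupling :: "'i set \<Rightarrow> 'b cinf \<Rightarrow> ('i \<Rightarrow> 'b \<Rightarrow> 'a) \<Rightarrow> 'b \<Rightarrow> 'i \<Rightarrow> 'a" where
  "tupling I B h = (\<lambda>x\<in>carrier B. \<lambda>i\<in>I. h i x)"

text \<open>
  A formula of HOL cannot quantify over types. A universal property therefore takes the type of
  the elements of its test objects as a parameter; a theorem in which this parameter is a free
  type variable asserts the property for all test objects.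
\<close>

definition is_cinf_product ::
    "'d itself \<Rightarrow> 'i set \<Rightarrow> ('i \<Rightarrow> 'a cinf) \<Rightarrow> 'p cinf \<Rightarrow> ('i \<Rightarrow> 'p \<Rightarrow> 'a) \<Rightarrow> bool" where
  "is_cinf_product _ I A P p \<longleftrightarrow>
     cinf_ring P \<and> (\<forall>i\<in>I. p i \<in> cinf_hom P (A i)) \<and>
     (\<forall>B :: 'd cinf. cinf_ring B \<longrightarrow>
        (\<forall>h. (\<forall>i\<in>I. h i \<in> cinf_hom B (A i)) \<longrightarrow>
           (\<exists>!g. g \<in> cinf_hom B P \<and> (\<forall>i\<in>I. compose (carrier B) (p i) g = h i))))"


section \<open>The von Neumann regular hull\<close>

definition is_vn_hull :: "'d itself \<Rightarrow> 'a cinf \<Rightarrow> 'v cinf \<Rightarrow> ('a \<Rightarrow> 'v) \<Rightarrow> bool" where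
  "is_vn_hull _ A V \<eta> \<longleftrightarrow>
     vn_regular_cinf_ring V \<and> \<eta> \<in> cinf_hom A V \<and>
     (\<forall>B :: 'd cinf. vn_regular_cinf_ring B \<longrightarrow>
        (\<forall>f\<in>cinf_hom A B. \<exists>!g. g \<in> cinf_hom V B \<and> compose (carrier A) g \<eta> = f))"

definition vn_lift :: "'a cinf \<Rightarrow> 'v cinf \<Rightarrow> ('a \<Rightarrow> 'v) \<Rightarrow> 'b cinf \<Rightarrow> ('a \<Rightarrow> 'b) \<Rightarrow> 'v \<Rightarrow> 'b" where
  "vn_lift A V \<eta> B f = (THE g. g \<in> cinf_hom V B \<and> compose (carrier A) g \<eta> = f)"

text \<open>
  A type with room for a hull of every C-infinity ring with elements of type 'a: the elements of the
  hull are sets of terms built from elements of type 'a by smooth operations and a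
  quasi-inverse.
\<close>

datatype 'a vn_term =
    Gen 'a
  | Op nat "(nat \<Rightarrow> real) \<Rightarrow> real" "nat \<Rightarrow> 'a vn_term"
  | QInv "'a vn_term"

text \<open>
  The functor is an arbitrary choice of hulls. The choice only asks for the universal property
  with respect to test rings in the type of the hull itself; the theorem \<open>vn_hull\<close> below shows
  that a hull exists and that the chosen one has the universal property with respect to all types.
\<close>

definition vn_choice :: "'a cinf \<Rightarrow> 'a vn_term set cinf \<times> ('a \<Rightarrow> 'a vn_term set)" where
  "vn_choice A = (SOME (V, \<eta>). is_vn_hull TYPE('a vn_term set) A V \<eta>)"

definition vN :: "'a cinf \<Rightarrow> 'a vn_term set cinf" where
  "vN A = fst (vn_choice A)"

definition vn_unit :: "'a cinf \<Rightarrow> 'a \<Rightarrow> 'a vn_term set" where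
  "vn_unit A = snd (vn_choice A)"

definition vN_map :: "'a cinf \<Rightarrow> 'b cinf \<Rightarrow> ('a \<Rightarrow> 'b) \<Rightarrow> 'a vn_term set \<Rightarrow> 'b vn_term set" where
  "vN_map A B f = vn_lift A (vN A) (vn_unit A) (vN B) (compose (carrier A) (vn_unit B) f)"


section \<open>Polynomial functions are smooth\<close>

lemma euclid_upd: "x \<in> euclid n \<Longrightarrow> i < n \<Longrightarrow> x(i := t) \<in> euclid n"
  by (auto simp: euclid_def PiE_def extensional_def)

lemma partial_deriv_cong:
  assumes "\<And>x. x \<in> euclid n \<Longrightarrow> f x = g x" "i < n"
  shows "partial_deriv n i f = partial_deriv n i g"
  unfolding partial_deriv_def by (rule restrict_ext) (simp add: assms euclid_upd)

lemma C_diff_cong: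
  assumes "\<And>x. x \<in> euclid n \<Longrightarrow> f x = g x"
  shows "C_diff n k f \<longleftrightarrow> C_diff n k g"
proof (cases k)
  case 0
  then show ?thesis using continuous_on_cong[OF refl assms] by simp
next
  case (Suc m)
  have "continuous_on (euclid n) f \<longleftrightarrow> continuous_on (euclid n) g"
    using continuous_on_cong[OF refl assms] .
  moreover have "(\<lambda>t. f (x(i := t))) = (\<lambda>t. g (x(i := t)))" if "x \<in> euclid n" "i < n" for x i
    using that assms by (simp add: euclid_upd)
  moreover have "partial_deriv n i f = partial_deriv n i g" if "i < n" for i
    by (rule partial_deriv_cong) (use assms that in auto)
  ultimately show ?thesis unfolding Suc by auto
qed

lemma C_diff_continuous: "C_diff n k f \<Longrightarrow> continuous_on (euclid n) f"
  by (cases k) auto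

lemma C_diff_Suc_D: "C_diff n (Suc k) f \<Longrightarrow> C_diff n k f"
proof (induction k arbitrary: f)
  case (Suc k)
  then show ?case by (metis C_diff.simps(2))
qed auto

lemma C_diff_const: "C_diff n k (\<lambda>x. c)"
proof (induction k arbitrary: c)
  case (Suc k)
  have "C_diff n k (partial_deriv n i (\<lambda>x. c))" for i
    using Suc[of 0] C_diff_cong[of n "partial_deriv n i (\<lambda>x. c)" "\<lambda>x. 0" k]
    by (simp add: partial_deriv_def)
  then show ?case by simp
qed simp

lemma continuous_on_coord: "continuous_on (euclid n) (\<lambda>x. x i)"
  using continuous_on_product_then_coordinatewise[of "euclid n" "\<lambda>x. x"] continuous_on_id by blast

lemma C_diff_coord: "C_diff n k (\<lambda>x. x i)"
proof (cases k)
  case 0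
  then show ?thesis by (simp add: continuous_on_coord)
next
  case (Suc m)
  have 1: "(\<lambda>t. (x(j := t)) i) = (if i = j then (\<lambda>t. t) else (\<lambda>t. x i))" for j and x :: "nat \<Rightarrow> real"
    by auto
  have "C_diff n m (partial_deriv n j (\<lambda>x. x i))" for j
    using C_diff_const[of n m "if i = j then 1 else 0"]
      C_diff_cong[of n "partial_deriv n j (\<lambda>x. x i)" "\<lambda>x. if i = j then 1 else 0" m]
    unfolding partial_deriv_def 1 by (auto split: if_splits)
  moreover have "(\<lambda>t. (x(j := t)) i) field_differentiable at (x j)" for j and x :: "nat \<Rightarrow> real"
    unfolding 1 by auto
  ultimately show ?thesis unfolding Suc
    by (simp add: continuous_on_coord)
qed

lemma C_diff_add: "C_diff n k f \<Longrightarrow> C_diff n k g \<Longrightarrow> C_diff n k (\<lambda>x. f x + g x)"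
proof (induction k arbitrary: f g)
  case 0
  then show ?case by (auto intro: continuous_intros)
next
  case (Suc k)
  have "C_diff n k (partial_deriv n i (\<lambda>x. f x + g x))" if i: "i < n" for i
  proof -
    have "C_diff n k (\<lambda>x. partial_deriv n i f x + partial_deriv n i g x)"
      using Suc i by auto
    moreover have "partial_deriv n i (\<lambda>x. f x + g x) x = partial_deriv n i f x + partial_deriv n i g x"
      if "x \<in> euclid n" for x
    proof -
      have "(\<lambda>t. f (x(i := t))) field_differentiable at (x i)"
        "(\<lambda>t. g (x(i := t))) field_differentiable at (x i)"
        using Suc.prems i that by auto
      from deriv_add[OF this] show ?thesis using that by (simp add: partial_deriv_def)
    qed
    ultimately show ?thesis
      using C_diff_cong[of n "partial_deriv n i (\<lambda>x. f x + g x)" "\<lambda>x. partial_deriv n i f x + partial_deriv n i g x" k] by simp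
  qed
  moreover have "continuous_on (euclid n) (\<lambda>x. f x + g x)"
    using Suc.prems by (intro continuous_on_add) auto
  ultimately show ?case using Suc.prems by (simp add: field_differentiable_add)
qed

lemma C_diff_mult: "C_diff n k f \<Longrightarrow> C_diff n k g \<Longrightarrow> C_diff n k (\<lambda>x. f x * g x)"
proof (induction k arbitrary: f g)
  case 0
  then show ?case by (auto intro: continuous_intros)
next
  case (Suc k)
  have "C_diff n k (partial_deriv n i (\<lambda>x. f x * g x))" if i: "i < n" for i
  proof -
    have fg: "C_diff n k f" "C_diff n k g"
      using Suc.prems C_diff_Suc_D by blast+
    have "C_diff n k (partial_deriv n i f)" "C_diff n k (partial_deriv n i g)"
      using Suc.prems i by auto
    then have "C_diff n k (\<lambda>x. f x * partial_deriv n i g x + partial_deriv n i f x * g x)"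
      using fg by (intro C_diff_add Suc.IH)
    moreover have "partial_deriv n i (\<lambda>x. f x * g x) x
        = f x * partial_deriv n i g x + partial_deriv n i f x * g x"
      if "x \<in> euclid n" for x
    proof -
      have "(\<lambda>t. f (x(i := t))) field_differentiable at (x i)"
        "(\<lambda>t. g (x(i := t))) field_differentiable at (x i)"
        using Suc.prems i that by auto
      from deriv_mult[OF this] show ?thesis using that by (simp add: partial_deriv_def)
    qed
    ultimately show ?thesis
      using C_diff_cong[of n "partial_deriv n i (\<lambda>x. f x * g x)" "\<lambda>x. f x * partial_deriv n i g x + partial_deriv n i f x * g x" k] by simp
  qed
  moreover have "continuous_on (euclid n) (\<lambda>x. f x * g x)"
    using Suc.prems by (intro continuous_on_mult) auto
  ultimately show ?case using Suc.prems by (simp add: field_differentiable_mult)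
qed

lemma smooth_restrict: "(\<And>k. C_diff n k f) \<Longrightarrow> restrict f (euclid n) \<in> smooth n"
  unfolding smooth_def using C_diff_cong[of n "restrict f (euclid n)" f] by auto

lemma coord_smooth: "coord n i \<in> smooth n"
  unfolding coord_def by (rule smooth_restrict[OF C_diff_coord])

lemma const_smooth: "const_smooth n c \<in> smooth n"
  unfolding const_smooth_def by (rule smooth_restrict[OF C_diff_const])

lemma add_smooth: "f \<in> smooth n \<Longrightarrow> g \<in> smooth n \<Longrightarrow> add_smooth n f g \<in> smooth n"
  unfolding add_smooth_def by (rule smooth_restrict[OF C_diff_add]) (auto simp: smooth_def)

lemma mult_smooth: "f \<in> smooth n \<Longrightarrow> g \<in> smooth n \<Longrightarrow> mult_smooth n f g \<in> smooth n"
  unfolding mult_smooth_def by (rule smooth_restrict[OF C_diff_mult]) (auto simp: smooth_def)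

lemmas smooth_intros = coord_smooth const_smooth add_smooth mult_smooth


section \<open>The underlying ring\<close>

lemma cinf_ring_closed: "cinf_ring A \<Longrightarrow> f \<in> smooth n \<Longrightarrow> a \<in> tuples A n \<Longrightarrow> opn A n f a \<in> carrier A"
  by (auto simp: cinf_ring_def)

lemma cinf_ring_coord: "cinf_ring A \<Longrightarrow> i < n \<Longrightarrow> a \<in> tuples A n \<Longrightarrow> opn A n (coord n i) a = a i"
  by (auto simp: cinf_ring_def)

lemma cinf_ring_comp:
  "cinf_ring A \<Longrightarrow> f \<in> smooth m \<Longrightarrow> (\<And>j. j < m \<Longrightarrow> g j \<in> smooth n) \<Longrightarrow> a \<in> tuples A n \<Longrightarrow>
     opn A n (comp_smooth n m f g) a = opn A m f (\<lambda>j\<in>{..<m}. opn A n (g j) a)"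
  by (auto simp: cinf_ring_def)

lemma pair_tuples: "a \<in> carrier A \<Longrightarrow> b \<in> carrier A \<Longrightarrow> pair a b \<in> tuples A 2"
  by (auto simp: pair_def tuples_def)

lemma comp_pair_eval: "(\<lambda>j\<in>{..<2}. F (if j = 0 then p else q)) = pair (F p) (F q)"
  by (auto simp: pair_def fun_eq_iff)

lemma pair_euclid: "pair (s::real) t \<in> euclid 2"
  by (auto simp: pair_def euclid_def)

lemma mult_smooth_comp:
  "mult_smooth n p q = comp_smooth n 2 (mult_smooth 2 (coord 2 0) (coord 2 1)) (\<lambda>j. if j = 0 then p else q)"
proof -
  have "(\<lambda>j\<in>{..<2}. (if j = 0 then p else q) x) = pair (p x) (q x)" for x
    by (auto simp: pair_def fun_eq_iff)
  then show ?thesis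
    using pair_euclid by (simp add: mult_smooth_def comp_smooth_def coord_def) (simp add: pair_def)
qed

lemma add_smooth_comp:
  "add_smooth n p q = comp_smooth n 2 (add_smooth 2 (coord 2 0) (coord 2 1)) (\<lambda>j. if j = 0 then p else q)"
proof -
  have "(\<lambda>j\<in>{..<2}. (if j = 0 then p else q) x) = pair (p x) (q x)" for x
    by (auto simp: pair_def fun_eq_iff)
  then show ?thesis
    using pair_euclid by (simp add: add_smooth_def comp_smooth_def coord_def) (simp add: pair_def)
qed

lemma const_smooth_comp:
  "const_smooth n c = comp_smooth n 0 (const_smooth 0 c) g"
  by (simp add: const_smooth_def comp_smooth_def euclid_def restrict_def)

lemma underlying_ring_carrier [simp]: "carrier (underlying_ring A) = carrier A"
  by (simp add: underlying_ring_def)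

lemma opn_mult:
  assumes "cinf_ring A" "p \<in> smooth n" "q \<in> smooth n" "a \<in> tuples A n"
  shows "opn A n (mult_smooth n p q) a = opn A n p a \<otimes>\<^bsub>underlying_ring A\<^esub> opn A n q a"
proof -
  have "opn A n (mult_smooth n p q) a = opn A 2 (mult_smooth 2 (coord 2 0) (coord 2 1))
     (\<lambda>j\<in>{..<2}. opn A n (if j = 0 then p else q) a)"
    unfolding mult_smooth_comp[of n]
    by (rule cinf_ring_comp) (use assms in \<open>auto intro: smooth_intros\<close>)
  then show ?thesis by (simp add: underlying_ring_def comp_pair_eval[of "\<lambda>p. opn A n p a"])
qed

lemma opn_add:
  assumes "cinf_ring A" "p \<in> smooth n" "q \<in> smooth n" "a \<in> tuples A n"
  shows "opn A n (add_smooth n p q) a = opn A n p a \<oplus>\<^bsub>underlying_ring A\<^esub> opn A n q a"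
proof -
  have "opn A n (add_smooth n p q) a = opn A 2 (add_smooth 2 (coord 2 0) (coord 2 1))
     (\<lambda>j\<in>{..<2}. opn A n (if j = 0 then p else q) a)"
    unfolding add_smooth_comp[of n]
    by (rule cinf_ring_comp) (use assms in \<open>auto intro: smooth_intros\<close>)
  then show ?thesis by (simp add: underlying_ring_def comp_pair_eval[of "\<lambda>p. opn A n p a"])
qed

lemma opn_const:
  assumes "cinf_ring A" "a \<in> tuples A n"
  shows "opn A n (const_smooth n c) a = opn A 0 (const_smooth 0 c) (\<lambda>_. undefined)"
proof -
  have "opn A n (const_smooth n c) a
      = opn A 0 (const_smooth 0 c) (\<lambda>j\<in>{..<0}. opn A n (const_smooth n 0) a)"
    unfolding const_smooth_comp[of n c "\<lambda>_. const_smooth n 0"]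
    by (rule cinf_ring_comp) (use assms in \<open>auto intro: smooth_intros\<close>)
  then show ?thesis by (simp add: restrict_def)
qed

lemma opn_one:
  "cinf_ring A \<Longrightarrow> a \<in> tuples A n \<Longrightarrow> opn A n (const_smooth n 1) a = \<one>\<^bsub>underlying_ring A\<^esub>"
  by (subst opn_const) (auto simp: underlying_ring_def)

lemma opn_zero:
  "cinf_ring A \<Longrightarrow> a \<in> tuples A n \<Longrightarrow> opn A n (const_smooth n 0) a = \<zero>\<^bsub>underlying_ring A\<^esub>"
  by (subst opn_const) (auto simp: underlying_ring_def)

theorem underlying_cring:
  assumes A: "cinf_ring A"
  shows "cring (underlying_ring A)"
proof -
  let ?R = "underlying_ring A"
  define v where "v = (\<lambda>a b c :: 'a. \<lambda>j\<in>{..<3::nat}. if j = 0 then a else if j = 1 then b else c)"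
  have v: "v a b c \<in> tuples A 3" if "a \<in> carrier A" "b \<in> carrier A" "c \<in> carrier A" for a b c
    using that by (auto simp: v_def tuples_def)
  have c0: "opn A 3 (coord 3 0) (v a b c) = a"
    and c1: "opn A 3 (coord 3 1) (v a b c) = b"
    and c2: "opn A 3 (coord 3 2) (v a b c) = c"
    if "a \<in> carrier A" "b \<in> carrier A" "c \<in> carrier A" for a b c
    using cinf_ring_coord[OF A _ v[OF that]] by (simp_all add: v_def)
  note ev = c0 c1 c2 opn_mult[OF A _ _ v] opn_add[OF A _ _ v] opn_one[OF A v] opn_zero[OF A v]
  note si = smooth_intros
  have cl: "opn A 3 f (v a b c) \<in> carrier A"
    if "f \<in> smooth 3" "a \<in> carrier A" "b \<in> carrier A" "c \<in> carrier A" for f a b c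
    using cinf_ring_closed[OF A that(1) v[OF that(2-)]] .
  let ?x = "coord 3 0" and ?y = "coord 3 1" and ?z = "coord 3 2"
  let ?m = "mult_smooth 3" and ?a = "add_smooth 3" and ?c = "const_smooth 3"
  have e: "?m ?x ?y = ?m ?y ?x" "?a ?x ?y = ?a ?y ?x"
    "?m (?m ?x ?y) ?z = ?m ?x (?m ?y ?z)" "?a (?a ?x ?y) ?z = ?a ?x (?a ?y ?z)"
    "?m (?a ?x ?y) ?z = ?a (?m ?x ?z) (?m ?y ?z)"
    "?m (?c 1) ?x = ?x" "?a (?c 0) ?x = ?x" "?a (?m (?c (-1)) ?x) ?x = ?c 0"
    by (auto simp: mult_smooth_def add_smooth_def const_smooth_def coord_def fun_eq_iff algebra_simps)
  have nul: "(\<lambda>_. undefined) \<in> tuples A 0" by (auto simp: tuples_def)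
  have one: "\<one>\<^bsub>?R\<^esub> \<in> carrier ?R" and zero: "\<zero>\<^bsub>?R\<^esub> \<in> carrier ?R"
    using cinf_ring_closed[OF A const_smooth nul] by (auto simp: underlying_ring_def)
  have m: "a \<otimes>\<^bsub>?R\<^esub> b \<in> carrier ?R" and p: "a \<oplus>\<^bsub>?R\<^esub> b \<in> carrier ?R"
    if "a \<in> carrier ?R" "b \<in> carrier ?R" for a b
    using cl[of "?m ?x ?y" a b b] cl[of "?a ?x ?y" a b b] that by (simp_all add: ev si del: One_nat_def)
  have mc: "a \<otimes>\<^bsub>?R\<^esub> b = b \<otimes>\<^bsub>?R\<^esub> a" and ac: "a \<oplus>\<^bsub>?R\<^esub> b = b \<oplus>\<^bsub>?R\<^esub> a"
    if "a \<in> carrier ?R" "b \<in> carrier ?R" for a b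
    using arg_cong[OF e(1), of "\<lambda>f. opn A 3 f (v a b b)"]
      arg_cong[OF e(2), of "\<lambda>f. opn A 3 f (v a b b)"] that by (simp_all add: ev si del: One_nat_def)
  have ma: "a \<otimes>\<^bsub>?R\<^esub> b \<otimes>\<^bsub>?R\<^esub> c = a \<otimes>\<^bsub>?R\<^esub> (b \<otimes>\<^bsub>?R\<^esub> c)"
    and aa: "a \<oplus>\<^bsub>?R\<^esub> b \<oplus>\<^bsub>?R\<^esub> c = a \<oplus>\<^bsub>?R\<^esub> (b \<oplus>\<^bsub>?R\<^esub> c)"
    and di: "(a \<oplus>\<^bsub>?R\<^esub> b) \<otimes>\<^bsub>?R\<^esub> c = a \<otimes>\<^bsub>?R\<^esub> c \<oplus>\<^bsub>?R\<^esub> b \<otimes>\<^bsub>?R\<^esub> c"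
    if "a \<in> carrier ?R" "b \<in> carrier ?R" "c \<in> carrier ?R" for a b c
    using arg_cong[OF e(3), of "\<lambda>f. opn A 3 f (v a b c)"]
      arg_cong[OF e(4), of "\<lambda>f. opn A 3 f (v a b c)"]
      arg_cong[OF e(5), of "\<lambda>f. opn A 3 f (v a b c)"] that by (simp_all add: ev si del: One_nat_def)
  have lo: "\<one>\<^bsub>?R\<^esub> \<otimes>\<^bsub>?R\<^esub> a = a" and lz: "\<zero>\<^bsub>?R\<^esub> \<oplus>\<^bsub>?R\<^esub> a = a"
    if "a \<in> carrier ?R" for a
    using arg_cong[OF e(6), of "\<lambda>f. opn A 3 f (v a a a)"]
      arg_cong[OF e(7), of "\<lambda>f. opn A 3 f (v a a a)"] that by (simp_all add: ev si del: One_nat_def)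
  have ne: "\<exists>b\<in>carrier ?R. b \<oplus>\<^bsub>?R\<^esub> a = \<zero>\<^bsub>?R\<^esub>" if "a \<in> carrier ?R" for a
  proof
    let ?f = "?m (?c (-1)) ?x"
    show "opn A 3 ?f (v a a a) \<in> carrier ?R"
      using that by (simp add: cl si del: One_nat_def)
    have "opn A 3 (?a ?f ?x) (v a a a) = opn A 3 ?f (v a a a) \<oplus>\<^bsub>?R\<^esub> opn A 3 ?x (v a a a)"
      by (rule opn_add[OF A _ _ v]) (use that in \<open>auto intro: si\<close>)
    then show "opn A 3 ?f (v a a a) \<oplus>\<^bsub>?R\<^esub> a = \<zero>\<^bsub>?R\<^esub>"
      using that unfolding e(8) by (simp add: ev del: One_nat_def)
  qed
  show ?thesis
  proof (rule cringI)
    show "abelian_group ?R"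
      by (rule abelian_groupI) (use p zero aa ac lz ne in auto)
    show "comm_monoid ?R"
      by (rule comm_monoidI) (use m one ma mc lo in auto)
  qed (use di in auto)
qed

lemma hom_mult:
  assumes h: "h \<in> cinf_hom A B" and "a \<in> carrier A" "b \<in> carrier A"
  shows "h (a \<otimes>\<^bsub>underlying_ring A\<^esub> b) = h a \<otimes>\<^bsub>underlying_ring B\<^esub> h b"
proof -
  have "h (opn A 2 (mult_smooth 2 (coord 2 0) (coord 2 1)) (pair a b))
      = opn B 2 (mult_smooth 2 (coord 2 0) (coord 2 1)) (\<lambda>j\<in>{..<2}. h (pair a b j))"
    using h pair_tuples[OF assms(2,3)] smooth_intros unfolding cinf_hom_def by blast
  moreover have "(\<lambda>j\<in>{..<2}. h (pair a b j)) = pair (h a) (h b)"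
    by (auto simp: pair_def fun_eq_iff)
  ultimately show ?thesis by (simp add: underlying_ring_def)
qed

lemma hom_closed: "h \<in> cinf_hom A B \<Longrightarrow> a \<in> carrier A \<Longrightarrow> h a \<in> carrier B"
  by (auto simp: cinf_hom_def)

lemma hom_opn:
  "h \<in> cinf_hom A B \<Longrightarrow> f \<in> smooth n \<Longrightarrow> a \<in> tuples A n \<Longrightarrow>
     h (opn A n f a) = opn B n f (\<lambda>j\<in>{..<n}. h (a j))"
  by (auto simp: cinf_hom_def)

lemma hom_tuples: "h \<in> cinf_hom A B \<Longrightarrow> a \<in> tuples A n \<Longrightarrow> (\<lambda>j\<in>{..<n}. h (a j)) \<in> tuples B n"
  by (auto simp: tuples_def cinf_hom_def)

lemma hom_compose:
  assumes A: "cinf_ring A" and h: "h \<in> cinf_hom A B" and g: "g \<in> cinf_hom B C"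
  shows "compose (carrier A) g h \<in> cinf_hom A C"
proof -
  have "compose (carrier A) g h (opn A n f a) = opn C n f (\<lambda>j\<in>{..<n}. compose (carrier A) g h (a j))"
    if f: "f \<in> smooth n" and a: "a \<in> tuples A n" for n f a
  proof -
    have "g (h (opn A n f a)) = opn C n f (\<lambda>j\<in>{..<n}. g ((\<lambda>j\<in>{..<n}. h (a j)) j))"
      using hom_opn[OF h f a] hom_opn[OF g f hom_tuples[OF h a]] by simp
    moreover have "(\<lambda>j\<in>{..<n}. g ((\<lambda>j\<in>{..<n}. h (a j)) j)) = (\<lambda>j\<in>{..<n}. compose (carrier A) g h (a j))"
      using a by (intro restrict_ext) (auto simp: compose_def tuples_def)
    moreover have "compose (carrier A) g h (opn A n f a) = g (h (opn A n f a))"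
      using cinf_ring_closed[OF A f a] by (simp add: compose_def)
    ultimately show ?thesis by (simp only:)
  qed
  moreover have "compose (carrier A) g h \<in> carrier A \<rightarrow>\<^sub>E carrier C"
    using h g by (auto simp: cinf_hom_def compose_def)
  ultimately show ?thesis by (simp add: cinf_hom_def)
qed


section \<open>Existence of the hull\<close>

definition quasi_inverse :: "'a ring \<Rightarrow> 'a \<Rightarrow> 'a \<Rightarrow> bool" where
  "quasi_inverse R a x \<longleftrightarrow>
     x \<in> carrier R \<and> a = a \<otimes>\<^bsub>R\<^esub> a \<otimes>\<^bsub>R\<^esub> x \<and> x = x \<otimes>\<^bsub>R\<^esub> x \<otimes>\<^bsub>R\<^esub> a"

lemma quasi_inverse_unique:
  assumes "cring R" and a: "a \<in> carrier R"
    and x: "quasi_inverse R a x" and y: "quasi_inverse R a y"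
  shows "x = y"
proof -
  interpret cring R by fact
  have c: "x \<in> carrier R" "y \<in> carrier R"
    and xa: "a \<otimes>\<^bsub>R\<^esub> a \<otimes>\<^bsub>R\<^esub> x = a" "x \<otimes>\<^bsub>R\<^esub> x \<otimes>\<^bsub>R\<^esub> a = x"
    and ya: "a \<otimes>\<^bsub>R\<^esub> a \<otimes>\<^bsub>R\<^esub> y = a" "y \<otimes>\<^bsub>R\<^esub> y \<otimes>\<^bsub>R\<^esub> a = y"
    using x y by (auto simp: quasi_inverse_def)
  have "x \<otimes>\<^bsub>R\<^esub> a = x \<otimes>\<^bsub>R\<^esub> (a \<otimes>\<^bsub>R\<^esub> a \<otimes>\<^bsub>R\<^esub> y)"
    by (simp add: ya)
  also have "\<dots> = a \<otimes>\<^bsub>R\<^esub> a \<otimes>\<^bsub>R\<^esub> x \<otimes>\<^bsub>R\<^esub> y"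
    using a c by (simp add: m_ac)
  finally have e: "x \<otimes>\<^bsub>R\<^esub> a = a \<otimes>\<^bsub>R\<^esub> y" by (simp add: xa)
  have "x = x \<otimes>\<^bsub>R\<^esub> (x \<otimes>\<^bsub>R\<^esub> a)"
    using a c xa by (simp add: m_assoc)
  also have "\<dots> = (x \<otimes>\<^bsub>R\<^esub> a) \<otimes>\<^bsub>R\<^esub> y"
    unfolding e using a c by (simp add: m_assoc[symmetric] e)
  also have "\<dots> = y \<otimes>\<^bsub>R\<^esub> y \<otimes>\<^bsub>R\<^esub> a"
    unfolding e using a c by (simp add: m_ac)
  finally show ?thesis by (simp add: ya)
qed

lemma (in cring) square: "a \<in> carrier R \<Longrightarrow> a [^] (2::nat) = a \<otimes> a"
  by (simp add: numeral_2_eq_2)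

lemma quasi_inverse_exists:
  assumes "cring R" and reg: "von_neumann_regular R" and a: "a \<in> carrier R"
  shows "\<exists>x. quasi_inverse R a x"
proof -
  interpret cring R by fact
  obtain y where y: "y \<in> carrier R" and e: "a = a \<otimes>\<^bsub>R\<^esub> a \<otimes>\<^bsub>R\<^esub> y"
    using reg a by (auto simp: von_neumann_regular_def square)
  let ?x = "y \<otimes>\<^bsub>R\<^esub> y \<otimes>\<^bsub>R\<^esub> a"
  have "a \<otimes>\<^bsub>R\<^esub> a \<otimes>\<^bsub>R\<^esub> ?x = (a \<otimes>\<^bsub>R\<^esub> a \<otimes>\<^bsub>R\<^esub> y) \<otimes>\<^bsub>R\<^esub> a \<otimes>\<^bsub>R\<^esub> y"
    using a y by (simp add: m_ac)
  then have 1: "a \<otimes>\<^bsub>R\<^esub> a \<otimes>\<^bsub>R\<^esub> ?x = a"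
    using e by simp
  have "?x \<otimes>\<^bsub>R\<^esub> ?x \<otimes>\<^bsub>R\<^esub> a = y \<otimes>\<^bsub>R\<^esub> y \<otimes>\<^bsub>R\<^esub> (a \<otimes>\<^bsub>R\<^esub> a \<otimes>\<^bsub>R\<^esub> ?x)"
    using a y by (simp add: m_ac)
  then have 2: "?x \<otimes>\<^bsub>R\<^esub> ?x \<otimes>\<^bsub>R\<^esub> a = ?x"
    using 1 by simp
  show ?thesis
    using 1 2 a y unfolding quasi_inverse_def by (metis m_closed)
qed

definition mult_term :: "'a vn_term \<Rightarrow> 'a vn_term \<Rightarrow> 'a vn_term" where
  "mult_term s t = Op 2 (mult_smooth 2 (coord 2 0) (coord 2 1)) (pair s t)"

inductive_set vn_terms :: "'a cinf \<Rightarrow> 'a vn_term set" for A where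
  Gen: "a \<in> carrier A \<Longrightarrow> Gen a \<in> vn_terms A"
| Op: "f \<in> smooth n \<Longrightarrow> (\<And>j. j < n \<Longrightarrow> t j \<in> vn_terms A) \<Longrightarrow> Op n f t \<in> vn_terms A"
| QInv: "t \<in> vn_terms A \<Longrightarrow> QInv t \<in> vn_terms A"

inductive vn_eq :: "'a cinf \<Rightarrow> 'a vn_term \<Rightarrow> 'a vn_term \<Rightarrow> bool" for A where
  refl: "vn_eq A t t"
| sym: "vn_eq A s t \<Longrightarrow> vn_eq A t s"
| trans: "vn_eq A r s \<Longrightarrow> vn_eq A s t \<Longrightarrow> vn_eq A r t"
| Op: "(\<And>j. j < n \<Longrightarrow> vn_eq A (s j) (t j)) \<Longrightarrow> vn_eq A (Op n f s) (Op n f t)"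
| QInv: "vn_eq A s t \<Longrightarrow> vn_eq A (QInv s) (QInv t)"
| gen: "f \<in> smooth n \<Longrightarrow> a \<in> tuples A n \<Longrightarrow> vn_eq A (Op n f (\<lambda>j. Gen (a j))) (Gen (opn A n f a))"
| coord: "i < n \<Longrightarrow> (\<And>j. j < n \<Longrightarrow> t j \<in> vn_terms A) \<Longrightarrow> vn_eq A (Op n (coord n i) t) (t i)"
| comp: "f \<in> smooth m \<Longrightarrow> (\<And>j. j < m \<Longrightarrow> g j \<in> smooth n) \<Longrightarrow> (\<And>j. j < n \<Longrightarrow> t j \<in> vn_terms A) \<Longrightarrow>
    vn_eq A (Op n (comp_smooth n m f g) t) (Op m f (\<lambda>j. Op n (g j) t))"
| qinv1: "t \<in> vn_terms A \<Longrightarrow> vn_eq A t (mult_term (mult_term t t) (QInv t))"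
| qinv2: "t \<in> vn_terms A \<Longrightarrow> vn_eq A (QInv t) (mult_term (mult_term (QInv t) (QInv t)) t)"

definition vn_class :: "'a cinf \<Rightarrow> 'a vn_term \<Rightarrow> 'a vn_term set" where
  "vn_class A t = {s. vn_eq A t s}"

definition vn_rep :: "'a cinf \<Rightarrow> 'a vn_term set \<Rightarrow> 'a vn_term" where
  "vn_rep A c = (SOME t. t \<in> vn_terms A \<and> vn_class A t = c)"

definition vn_model :: "'a cinf \<Rightarrow> 'a vn_term set cinf" where
  "vn_model A = \<lparr> carrier = vn_class A ` vn_terms A,
     opn = (\<lambda>n f c. vn_class A (Op n f (\<lambda>j. vn_rep A (c j)))) \<rparr>"

definition vn_model_unit :: "'a cinf \<Rightarrow> 'a \<Rightarrow> 'a vn_term set" where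
  "vn_model_unit A = (\<lambda>a\<in>carrier A. vn_class A (Gen a))"

primrec vn_eval :: "'b cinf \<Rightarrow> ('a \<Rightarrow> 'b) \<Rightarrow> 'a vn_term \<Rightarrow> 'b" where
  "vn_eval B h (Gen a) = h a"
| "vn_eval B h (Op n f t) = opn B n f (restrict (\<lambda>j. vn_eval B h (t j)) {..<n})"
| "vn_eval B h (QInv t) = (SOME x. quasi_inverse (underlying_ring B) (vn_eval B h t) x)"

lemma vn_class_eq: "vn_class A s = vn_class A t \<longleftrightarrow> vn_eq A s t"
  by (auto simp: vn_class_def intro: vn_eq.intros(1-3))

lemma vn_rep:
  assumes "c \<in> carrier (vn_model A)"
  shows "vn_rep A c \<in> vn_terms A" "vn_class A (vn_rep A c) = c"
proof -
  have "\<exists>t. t \<in> vn_terms A \<and> vn_class A t = c"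
    using assms by (auto simp: vn_model_def)
  from someI_ex[OF this] show "vn_rep A c \<in> vn_terms A" "vn_class A (vn_rep A c) = c"
    by (auto simp: vn_rep_def)
qed

lemma vn_model_carrier: "t \<in> vn_terms A \<Longrightarrow> vn_class A t \<in> carrier (vn_model A)"
  by (auto simp: vn_model_def)

lemma vn_model_opn:
  assumes "\<And>j. j < n \<Longrightarrow> t j \<in> vn_terms A"
  shows "opn (vn_model A) n f (\<lambda>j\<in>{..<n}. vn_class A (t j)) = vn_class A (Op n f t)"
proof -
  have "vn_eq A (vn_rep A (vn_class A (t j))) (t j)" if "j < n" for j
    using vn_rep[OF vn_model_carrier[OF assms[OF that]]] by (simp add: vn_class_eq)
  then show ?thesis
    by (auto simp: vn_model_def vn_class_eq intro: vn_eq.Op)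
qed

lemma vn_model_tuples:
  assumes "c \<in> tuples (vn_model A) n"
  obtains t where "\<And>j. j < n \<Longrightarrow> t j \<in> vn_terms A" "c = (\<lambda>j\<in>{..<n}. vn_class A (t j))"
proof
  show "vn_rep A (c j) \<in> vn_terms A" if "j < n" for j
    using assms that by (intro vn_rep) (auto simp: tuples_def)
  have "c j = vn_class A (vn_rep A (c j))" if "j < n" for j
    using assms that vn_rep(2)[of "c j" A] by (auto simp: tuples_def)
  then show "c = (\<lambda>j\<in>{..<n}. vn_class A (vn_rep A (c j)))"
    using assms by (auto simp: tuples_def PiE_def extensional_def fun_eq_iff)
qed

lemma vn_model_cinf_ring: "cinf_ring (vn_model A)"
  unfolding cinf_ring_def
proof (intro conjI allI ballI impI)
  fix n f c assume f: "f \<in> smooth n" and c: "c \<in> tuples (vn_model A) n"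
  show "opn (vn_model A) n f c \<in> carrier (vn_model A)"
    using c
  proof (cases rule: vn_model_tuples)
    case (1 t)
    have "Op n f t \<in> vn_terms A" using f 1(1) by (rule vn_terms.Op)
    then show ?thesis unfolding 1(2) by (simp add: vn_model_opn 1(1) vn_model_carrier)
  qed
next
  fix n i c assume i: "i < n" and c: "c \<in> tuples (vn_model A) n"
  show "opn (vn_model A) n (coord n i) c = c i"
    using c
  proof (cases rule: vn_model_tuples)
    case (1 t)
    have "vn_eq A (Op n (coord n i) t) (t i)" using i 1(1) by (rule vn_eq.coord)
    then show ?thesis unfolding 1(2) using i by (simp add: vn_model_opn 1(1) vn_class_eq)
  qed
next
  fix n m f g c assume f: "f \<in> smooth m" and g: "\<forall>j<m. g j \<in> smooth n"
    and c: "c \<in> tuples (vn_model A) n"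
  show "opn (vn_model A) n (comp_smooth n m f g) c
      = opn (vn_model A) m f (\<lambda>j\<in>{..<m}. opn (vn_model A) n (g j) c)"
    using c
  proof (cases rule: vn_model_tuples)
    case (1 t)
    have t: "Op n (g j) t \<in> vn_terms A" if "j < m" for j
      using g that 1(1) by (blast intro: vn_terms.Op)
    have "vn_eq A (Op n (comp_smooth n m f g) t) (Op m f (\<lambda>j. Op n (g j) t))"
      using f g 1(1) by (blast intro: vn_eq.comp)
    then have "vn_class A (Op n (comp_smooth n m f g) t) = vn_class A (Op m f (\<lambda>j. Op n (g j) t))"
      by (simp only: vn_class_eq)
    moreover have e: "opn (vn_model A) n h (\<lambda>j\<in>{..<n}. vn_class A (t j)) = vn_class A (Op n h t)" for h
      using 1(1) by (rule vn_model_opn)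
    moreover have "opn (vn_model A) m f (\<lambda>j\<in>{..<m}. vn_class A (Op n (g j) t))
        = vn_class A (Op m f (\<lambda>j. Op n (g j) t))"
      using t by (rule vn_model_opn)
    ultimately show ?thesis unfolding 1(2) by (simp only: e)
  qed
qed

lemma pair_terms: "s \<in> vn_terms A \<Longrightarrow> t \<in> vn_terms A \<Longrightarrow> j < 2 \<Longrightarrow> pair s t j \<in> vn_terms A"
  by (auto simp: pair_def)

lemma mult_term_terms: "s \<in> vn_terms A \<Longrightarrow> t \<in> vn_terms A \<Longrightarrow> mult_term s t \<in> vn_terms A"
  unfolding mult_term_def by (intro vn_terms.Op smooth_intros pair_terms)

lemma pair_map: "(\<lambda>j\<in>{..<2}. F (pair p q j)) = pair (F p) (F q)"
  by (auto simp: pair_def fun_eq_iff)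

lemma vn_model_mult:
  assumes "s \<in> vn_terms A" "t \<in> vn_terms A"
  shows "vn_class A s \<otimes>\<^bsub>underlying_ring (vn_model A)\<^esub> vn_class A t = vn_class A (mult_term s t)"
  using vn_model_opn[of 2 "pair s t" A, OF pair_terms[OF assms]]
  by (simp add: underlying_ring_def mult_term_def pair_map)

lemma vn_model_quasi_inverse:
  assumes t: "t \<in> vn_terms A"
  shows "quasi_inverse (underlying_ring (vn_model A)) (vn_class A t) (vn_class A (QInv t))"
proof -
  have q: "QInv t \<in> vn_terms A" using t by (rule vn_terms.QInv)
  show ?thesis
    unfolding quasi_inverse_def
    using vn_eq.qinv1[OF t] vn_eq.qinv2[OF t]
    by (simp add: vn_model_mult t q mult_term_terms vn_model_carrier vn_class_eq)
qed

lemma vn_model_regular: "vn_regular_cinf_ring (vn_model A)"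
proof -
  interpret cring "underlying_ring (vn_model A)"
    by (rule underlying_cring[OF vn_model_cinf_ring])
  have "\<exists>x\<in>carrier (vn_model A). c = c [^]\<^bsub>underlying_ring (vn_model A)\<^esub> (2::nat)
        \<otimes>\<^bsub>underlying_ring (vn_model A)\<^esub> x" if "c \<in> carrier (vn_model A)" for c
    using vn_model_quasi_inverse[OF vn_rep(1)[OF that]] that vn_rep(2)[OF that]
    by (auto simp: quasi_inverse_def square)
  then show ?thesis
    by (simp add: vn_regular_cinf_ring_def vn_model_cinf_ring von_neumann_regular_def)
qed

lemma vn_model_unit_hom: 
  assumes A: "cinf_ring A"
  shows "vn_model_unit A \<in> cinf_hom A (vn_model A)"
proof -
  have "vn_model_unit A (opn A n f a) = opn (vn_model A) n f (\<lambda>j\<in>{..<n}. vn_model_unit A (a j))"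
    if f: "f \<in> smooth n" and a: "a \<in> tuples A n" for n f a
  proof -
    have aj: "a j \<in> carrier A" if "j < n" for j
      using a that by (auto simp: tuples_def)
    have "(\<lambda>j\<in>{..<n}. vn_model_unit A (a j)) = (\<lambda>j\<in>{..<n}. vn_class A (Gen (a j)))"
      by (rule restrict_ext) (simp add: vn_model_unit_def aj)
    then have "opn (vn_model A) n f (\<lambda>j\<in>{..<n}. vn_model_unit A (a j))
        = vn_class A (Op n f (\<lambda>j. Gen (a j)))"
      using vn_model_opn[of n "\<lambda>j. Gen (a j)" A f] aj by (simp only: vn_terms.Gen)
    moreover have "vn_eq A (Gen (opn A n f a)) (Op n f (\<lambda>j. Gen (a j)))"
      by (rule vn_eq.sym[OF vn_eq.gen[OF f a]])
    ultimately show ?thesis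
      using cinf_ring_closed[OF A f a] by (simp only: vn_model_unit_def restrict_apply if_True vn_class_eq)
  qed
  moreover have "vn_model_unit A \<in> carrier A \<rightarrow>\<^sub>E carrier (vn_model A)"
    by (auto simp: vn_model_unit_def intro: vn_model_carrier vn_terms.Gen)
  ultimately show ?thesis by (simp add: cinf_hom_def)
qed

lemma regular_quasi_inverse:
  assumes "vn_regular_cinf_ring B" "b \<in> carrier B"
  shows "quasi_inverse (underlying_ring B) b (SOME x. quasi_inverse (underlying_ring B) b x)"
  by (rule someI_ex, rule quasi_inverse_exists)
    (use assms underlying_cring in \<open>auto simp: vn_regular_cinf_ring_def\<close>)

lemma vn_eval_closed:
  assumes B: "vn_regular_cinf_ring B" and h: "h \<in> cinf_hom A B" and t: "t \<in> vn_terms A"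
  shows "vn_eval B h t \<in> carrier B"
  using t
proof induction
  case (Gen a)
  then show ?case using h by (simp add: hom_closed)
next
  case (Op f n t)
  then show ?case using B
    by (auto simp: vn_regular_cinf_ring_def tuples_def intro!: cinf_ring_closed)
next
  case (QInv t)
  then show ?case using regular_quasi_inverse[OF B] by (simp add: quasi_inverse_def)
qed

lemma vn_eval_mult_term:
  "vn_eval B h (mult_term s t) = vn_eval B h s \<otimes>\<^bsub>underlying_ring B\<^esub> vn_eval B h t"
  by (simp add: mult_term_def underlying_ring_def pair_map)

lemma vn_eval_sound:
  assumes B: "vn_regular_cinf_ring B" and h: "h \<in> cinf_hom A B" and st: "vn_eq A s t"
  shows "vn_eval B h s = vn_eval B h t"
  using st
proof induction
  case (Op n s t f)
  then have "(\<lambda>j\<in>{..<n}. vn_eval B h (s j)) = (\<lambda>j\<in>{..<n}. vn_eval B h (t j))"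
    by (intro restrict_ext) auto
  then show ?case by simp
next
  case (gen f n a)
  then show ?case using hom_opn[OF h] by simp
next
  case (coord i n t)
  then have "(\<lambda>j\<in>{..<n}. vn_eval B h (t j)) \<in> tuples B n"
    using vn_eval_closed[OF B h] by (auto simp: tuples_def)
  then show ?case using B cinf_ring_coord[of B i n] coord(1)
    by (simp add: vn_regular_cinf_ring_def)
next
  case (comp f m g n t)
  then have "(\<lambda>j\<in>{..<n}. vn_eval B h (t j)) \<in> tuples B n"
    using vn_eval_closed[OF B h] by (auto simp: tuples_def)
  then show ?case using B cinf_ring_comp[of B f m g n] comp(1,2)
    by (simp add: vn_regular_cinf_ring_def)
next
  case (qinv1 t)
  show ?case unfolding vn_eval_mult_term
    using regular_quasi_inverse[OF B vn_eval_closed[OF B h qinv1]] by (simp add: quasi_inverse_def)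
next
  case (qinv2 t)
  show ?case unfolding vn_eval_mult_term
    using regular_quasi_inverse[OF B vn_eval_closed[OF B h qinv2]] by (simp add: quasi_inverse_def)
qed simp_all

lemma hom_quasi_inverse:
  assumes "g \<in> cinf_hom V B" "quasi_inverse (underlying_ring V) a x" "a \<in> carrier V" "cinf_ring V"
  shows "quasi_inverse (underlying_ring B) (g a) (g x)"
proof -
  interpret cring "underlying_ring V" by (rule underlying_cring) fact
  have x: "x \<in> carrier V" using assms(2) by (simp add: quasi_inverse_def)
  have "a \<otimes>\<^bsub>underlying_ring V\<^esub> a \<in> carrier V" "x \<otimes>\<^bsub>underlying_ring V\<^esub> x \<in> carrier V"
    using m_closed assms(3) x by simp_all
  then have "g (a \<otimes>\<^bsub>underlying_ring V\<^esub> a \<otimes>\<^bsub>underlying_ring V\<^esub> x)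
      = g a \<otimes>\<^bsub>underlying_ring B\<^esub> g a \<otimes>\<^bsub>underlying_ring B\<^esub> g x"
    "g (x \<otimes>\<^bsub>underlying_ring V\<^esub> x \<otimes>\<^bsub>underlying_ring V\<^esub> a)
      = g x \<otimes>\<^bsub>underlying_ring B\<^esub> g x \<otimes>\<^bsub>underlying_ring B\<^esub> g a"
    using assms(3) x by (simp_all add: hom_mult[OF assms(1)])
  then show ?thesis
    using assms(2) hom_closed[OF assms(1) x] by (simp add: quasi_inverse_def)
qed

lemma vn_model_hom_unique:
  assumes B: "vn_regular_cinf_ring B" and h: "h \<in> cinf_hom A B"
    and g: "g \<in> cinf_hom (vn_model A) B" "compose (carrier A) g (vn_model_unit A) = h"
    and t: "t \<in> vn_terms A"
  shows "g (vn_class A t) = vn_eval B h t"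
  using t
proof induction
  case (Gen a)
  then show ?case using fun_cong[OF g(2), of a] by (simp add: compose_def vn_model_unit_def)
next
  case (Op f n t)
  have tu: "(\<lambda>j\<in>{..<n}. vn_class A (t j)) \<in> tuples (vn_model A) n"
    using Op(2) by (auto simp: tuples_def intro: vn_model_carrier)
  have "g (vn_class A (Op n f t)) = opn B n f (\<lambda>j\<in>{..<n}. g ((\<lambda>j\<in>{..<n}. vn_class A (t j)) j))"
    using hom_opn[OF g(1) Op(1) tu] vn_model_opn[of n t A f, OF Op(2)] by simp
  moreover have "(\<lambda>j\<in>{..<n}. g ((\<lambda>j\<in>{..<n}. vn_class A (t j)) j)) = (\<lambda>j\<in>{..<n}. vn_eval B h (t j))"
    by (rule restrict_ext) (simp add: Op(3))
  ultimately show ?case by (simp only: vn_eval.simps)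
next
  case (QInv t)
  have "quasi_inverse (underlying_ring B) (g (vn_class A t)) (g (vn_class A (QInv t)))"
    by (rule hom_quasi_inverse[OF g(1) vn_model_quasi_inverse[OF QInv(1)]
          vn_model_carrier[OF QInv(1)] vn_model_cinf_ring])
  moreover have "quasi_inverse (underlying_ring B) (vn_eval B h t) (vn_eval B h (QInv t))"
    using regular_quasi_inverse[OF B vn_eval_closed[OF B h QInv(1)]] by simp
  moreover have "cring (underlying_ring B)"
    using B by (intro underlying_cring) (simp add: vn_regular_cinf_ring_def)
  ultimately show ?case
    using quasi_inverse_unique vn_eval_closed[OF B h QInv(1)] by (metis QInv(2) underlying_ring_carrier)
qed

theorem vn_model_is_hull:
  assumes A: "cinf_ring A"
  shows "is_vn_hull TYPE('d) A (vn_model A) (vn_model_unit A)"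
  unfolding is_vn_hull_def
proof (intro conjI allI impI ballI vn_model_regular vn_model_unit_hom[OF A])
  fix B :: "'d cinf" and h
  assume B: "vn_regular_cinf_ring B" and h: "h \<in> cinf_hom A B"
  define g where "g = (\<lambda>c\<in>carrier (vn_model A). vn_eval B h (vn_rep A c))"
  have gc: "g (vn_class A t) = vn_eval B h t" if "t \<in> vn_terms A" for t
    unfolding g_def using vn_rep[OF vn_model_carrier[OF that]] vn_model_carrier[OF that]
    by (auto simp: vn_class_eq intro: vn_eval_sound[OF B h])
  have "g (opn (vn_model A) n f c) = opn B n f (\<lambda>j\<in>{..<n}. g (c j))"
    if f: "f \<in> smooth n" and c: "c \<in> tuples (vn_model A) n" for n f c
    using c
  proof (cases rule: vn_model_tuples)
    case (1 t)
    have "(\<lambda>j\<in>{..<n}. g (c j)) = (\<lambda>j\<in>{..<n}. vn_eval B h (t j))"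
      unfolding 1(2) by (rule restrict_ext) (simp add: gc 1(1))
    moreover have "Op n f t \<in> vn_terms A" using f 1(1) by (rule vn_terms.Op)
    ultimately show ?thesis
      unfolding 1(2) by (simp only: vn_model_opn[of n t A f, OF 1(1)] gc vn_eval.simps)
  qed
  moreover have "g \<in> carrier (vn_model A) \<rightarrow>\<^sub>E carrier B"
    unfolding g_def by (auto intro: vn_eval_closed[OF B h] vn_rep)
  ultimately have gh: "g \<in> cinf_hom (vn_model A) B" by (simp add: cinf_hom_def)
  have "compose (carrier A) g (vn_model_unit A) x = h x" for x
    using h by (cases "x \<in> carrier A")
      (auto simp: compose_def vn_model_unit_def gc vn_terms.Gen cinf_hom_def PiE_def extensional_def)
  then have gu: "compose (carrier A) g (vn_model_unit A) = h" by blast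
  show "\<exists>!g. g \<in> cinf_hom (vn_model A) B \<and> compose (carrier A) g (vn_model_unit A) = h"
  proof (rule ex1I)
    show "g \<in> cinf_hom (vn_model A) B \<and> compose (carrier A) g (vn_model_unit A) = h"
      using gh gu by blast
  next
    fix k assume k: "k \<in> cinf_hom (vn_model A) B \<and> compose (carrier A) k (vn_model_unit A) = h"
    have "k c = g c" if "c \<in> carrier (vn_model A)" for c
      using that vn_model_hom_unique[OF B h, of k] k gc by (auto simp: vn_model_def)
    then show "k = g"
      using k gh by (auto simp: cinf_hom_def intro: PiE_ext)
  qed
qed

lemma hom_compose_assoc:
  "h \<in> cinf_hom A B \<Longrightarrow>
     compose (carrier A) (compose (carrier B) k g) h = compose (carrier A) k (compose (carrier A) g h)"
  by (auto simp: compose_def cinf_hom_def fun_eq_iff)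

lemma hom_id: "cinf_ring A \<Longrightarrow> (\<lambda>x\<in>carrier A. x) \<in> cinf_hom A A"
proof -
  assume A: "cinf_ring A"
  have "(\<lambda>j\<in>{..<n}. (\<lambda>x\<in>carrier A. x) (a j)) = a" if "a \<in> tuples A n" for n a
    using that by (auto simp: tuples_def PiE_def extensional_def fun_eq_iff)
  then show ?thesis using cinf_ring_closed[OF A] by (auto simp: cinf_hom_def)
qed

text \<open>
  A hull that is universal among the regular rings in its own type is isomorphic to the term
  model, which lives in the same type. Hence it inherits universality with respect to all types.
\<close>

theorem is_vn_hull_all_types:
  fixes A :: "'a cinf" and V :: "'a vn_term set cinf"
  assumes A: "cinf_ring A" and V: "is_vn_hull TYPE('a vn_term set) A V \<eta>"
  shows "is_vn_hull TYPE('d) A V \<eta>"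
proof -
  let ?U = "vn_model A" and ?u = "vn_model_unit A"
  have U: "is_vn_hull TYPE('a vn_term set) A ?U ?u" and Ud: "is_vn_hull TYPE('d) A ?U ?u"
    by (rule vn_model_is_hull[OF A])+
  have rV: "vn_regular_cinf_ring V" and eta: "\<eta> \<in> cinf_hom A V"
    using V by (auto simp: is_vn_hull_def)
  have cV: "cinf_ring V" using rV by (simp add: vn_regular_cinf_ring_def)
  note uh = vn_model_unit_hom[OF A]
  obtain p where p: "p \<in> cinf_hom V ?U" "compose (carrier A) p \<eta> = ?u"
    using V vn_model_regular uh unfolding is_vn_hull_def by blast
  obtain q where q: "q \<in> cinf_hom ?U V" "compose (carrier A) q ?u = \<eta>"
    using U rV eta unfolding is_vn_hull_def by blast
  have qp: "compose (carrier V) q p = (\<lambda>x\<in>carrier V. x)"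
  proof -
    have "\<exists>!k. k \<in> cinf_hom V V \<and> compose (carrier A) k \<eta> = \<eta>"
      using V rV eta unfolding is_vn_hull_def by blast
    moreover have "compose (carrier V) q p \<in> cinf_hom V V"
      by (rule hom_compose[OF cV p(1) q(1)])
    moreover have "compose (carrier A) (compose (carrier V) q p) \<eta> = \<eta>"
      by (simp add: hom_compose_assoc[OF eta] p q)
    moreover have "compose (carrier A) (\<lambda>x\<in>carrier V. x) \<eta> = \<eta>"
      using eta by (auto simp: cinf_hom_def compose_def PiE_def extensional_def fun_eq_iff)
    ultimately show ?thesis using hom_id[OF cV] by blast
  qed
  show ?thesis
    unfolding is_vn_hull_def
  proof (intro conjI allI impI ballI rV eta)
    fix B :: "'d cinf" and f
    assume B: "vn_regular_cinf_ring B" and f: "f \<in> cinf_hom A B"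
    obtain g where g: "g \<in> cinf_hom ?U B" "compose (carrier A) g ?u = f"
      and un: "\<And>k. k \<in> cinf_hom ?U B \<Longrightarrow> compose (carrier A) k ?u = f \<Longrightarrow> k = g"
      using Ud B f unfolding is_vn_hull_def by metis
    show "\<exists>!g. g \<in> cinf_hom V B \<and> compose (carrier A) g \<eta> = f"
    proof (rule ex1I)
      show "compose (carrier V) g p \<in> cinf_hom V B \<and>
          compose (carrier A) (compose (carrier V) g p) \<eta> = f"
        by (simp add: hom_compose[OF cV p(1) g(1)] hom_compose_assoc[OF eta] p g)
    next
      fix k assume k: "k \<in> cinf_hom V B \<and> compose (carrier A) k \<eta> = f"
      have "compose (carrier ?U) k q = g"
        using k by (intro un) (simp_all add: hom_compose[OF vn_model_cinf_ring q(1)]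
            hom_compose_assoc[OF uh] q)
      then have "compose (carrier V) g p = compose (carrier V) k (compose (carrier V) q p)"
        by (simp add: hom_compose_assoc[OF p(1), symmetric])
      also have "\<dots> = k"
        unfolding qp using k by (auto simp: cinf_hom_def compose_def PiE_def extensional_def fun_eq_iff)
      finally show "k = compose (carrier V) g p" by simp
    qed
  qed
qed

theorem vn_hull:
  assumes A: "cinf_ring A"
  shows "is_vn_hull TYPE('d) A (vN A) (vn_unit A)"
proof -
  have "case (vn_model A, vn_model_unit A) of (V, \<eta>) \<Rightarrow> is_vn_hull TYPE('a vn_term set) A V \<eta>"
    using vn_model_is_hull[OF A] by simp
  then have "case vn_choice A of (V, \<eta>) \<Rightarrow> is_vn_hull TYPE('a vn_term set) A V \<eta>"
    unfolding vn_choice_def by (rule someI)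
  then show ?thesis
    using is_vn_hull_all_types[OF A] by (auto simp: vN_def vn_unit_def split: prod.splits)
qed

end

theory Submission
  imports Defs "HOL-Computational_Algebra.Polynomial"
begin

text \<open>
  The theorem holds because a finite product of C-infinity rings is controlled by its idempotents. A
  homomorphism \<open>f\<close> from \<open>\<Prod>A\<^sub>i\<close> to a von Neumann regular \<open>B\<close> sends the standard idempotents to orthogonal
  idempotents \<open>\<epsilon>\<^sub>i\<close> of \<open>B\<close> with sum 1, and it splits into homomorphisms from the \<open>A\<^sub>i\<close> to the corners \<open>\<epsilon>\<^sub>i B\<close>
  (\<open>hom_axis_corner\<close>, \<open>hom_eq_sum_axis\<close>, \<open>sum_of_corner_homs\<close>). The corners are again regular
  (\<open>vn_regular_corner\<close>), so every part extends uniquely to the hull of \<open>A\<^sub>i\<close>, and adding the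
  extensions up gives the unique extension of \<open>f\<close> to the product of the hulls
  (\<open>prod_of_hulls_is_hull\<close>). The remaining claims follow formally from this universal property.

  The one analytic ingredient is that a corner \<open>e B\<close> carries smooth operations at all. This needs
  \<open>e f(x) = e f(e x)\<close> for every smooth \<open>f\<close> and idempotent \<open>e\<close> (\<open>opn_local_at_idempotent\<close>). It is usually
  derived from Hadamard's lemma, with an integral over a parameter and a general chain rule. Here it
  comes from an identity between explicit smooth functions, built from a smooth step that equals 0
  near 0 and 1 near 1 and whose value at \<open>e\<close> is \<open>e\<close>.
\<close>

section \<open>Smooth step functions\<close>

text \<open>
  The family of all functions equal to \<open>p(1/t) exp(-1/t)\<close> for positive \<open>t\<close> and to 0 elsewhere is closed
  under differentiation. Smoothness of the classical flat function, the case \<open>p = 1\<close>, is therefore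
  an induction that never computes a higher derivative. At 0 the difference quotients are again of
  this form, with \<open>p\<close> multiplied by the variable, and the exponential beats every polynomial.
\<close>

definition flat :: "real poly \<Rightarrow> real \<Rightarrow> real" where
  "flat p t = (if t > 0 then poly p (1 / t) * exp (- (1 / t)) else 0)"

definition flat_deriv :: "real poly \<Rightarrow> real poly" where
  "flat_deriv p = [:0, 0, 1:] * (p - pderiv p)"

lemma poly_exp_tendsto_0: "((\<lambda>s. poly p s * exp (- s)) \<longlongrightarrow> (0::real)) at_top"
proof (induction p)
  case (pCons a p)
  have "((\<lambda>s. s^k * exp (- s)) \<longlongrightarrow> (0::real)) at_top" for k
    using tendsto_power_div_exp_0[of k] by (simp add: exp_minus field_simps)
  moreover have "(\<lambda>s. poly q s * exp (- s)) = (\<lambda>s. \<Sum>k\<le>degree q. coeff q k * (s^k * exp (-s)))"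
    for q :: "real poly"
    by (simp add: poly_altdef sum_distrib_right mult.assoc)
  ultimately show ?case
    by (simp only:) (intro tendsto_null_sum tendsto_mult_right_zero)
qed simp

lemma flat_has_derivative:
  "(flat p has_real_derivative flat (flat_deriv p) t) (at t)"
proof -
  consider "t > 0" | "t < 0" | "t = 0" by linarith
  then show ?thesis
  proof cases
    case 1
    have "((\<lambda>t. poly p (1 / t) * exp (- (1 / t))) has_real_derivative flat (flat_deriv p) t) (at t)"
      using 1 by (auto intro!: derivative_eq_intros DERIV_chain2[OF poly_DERIV]
          simp: flat_def flat_deriv_def field_simps power2_eq_square)
    then show ?thesis
      by (rule has_field_derivative_transform_within_open[of _ _ _ "{0<..}"])
        (use 1 in \<open>auto simp: flat_def\<close>)
  next
    case 2
    have "((\<lambda>t. 0) has_real_derivative flat (flat_deriv p) t) (at t)"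
      using 2 by (auto simp: flat_def)
    then show ?thesis
      by (rule has_field_derivative_transform_within_open[of _ _ _ "{..<0}"])
        (use 2 in \<open>auto simp: flat_def\<close>)
  next
    case 3
    \<comment> \<open>From the right, substitute \<open>s = 1/h\<close>.\<close>
    have "((\<lambda>h. flat p h / h) \<longlongrightarrow> 0) (at_left 0)"
      by (rule tendsto_eventually) (auto simp: flat_def eventually_at_filter)
    moreover have "((\<lambda>h. flat p h / h) \<longlongrightarrow> 0) (at_right 0)"
    proof -
      have "((\<lambda>h. poly ([:0, 1:] * p) (inverse h) * exp (- inverse h)) \<longlongrightarrow> 0) (at_right 0)"
        by (rule filterlim_compose[OF poly_exp_tendsto_0 filterlim_inverse_at_top_right])
      then show ?thesis
        by (rule Lim_transform_eventually)
          (auto simp: flat_def eventually_at_filter field_simps)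
    qed
    ultimately show ?thesis
      using 3 by (simp add: DERIV_def filterlim_split_at flat_def)
  qed
qed

text \<open>
  A family of functions of one variable that contains a derivative of each of its members consists of
  smooth functions. Composition with a coordinate is the only composite needed, so that the chain rule
  for several variables is avoided.
\<close>

lemma C_diff_univariate:
  assumes "\<And>g. g \<in> G \<Longrightarrow> \<exists>g'\<in>G. \<forall>t. (g has_real_derivative g' t) (at t)" and "g \<in> G"
  shows "C_diff n k (\<lambda>x. g (x i))"
proof -
  have cont: "continuous_on (euclid n) (\<lambda>x. g (x i))" if "g \<in> G" for g
  proof (rule continuous_on_compose2[OF _ continuous_on_coord])
    show "continuous_on UNIV g"
      using assms(1)[OF that] by (meson DERIV_isCont continuous_at_imp_continuous_on)
  qed auto
  show ?thesis using assms(2)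
  proof (induction k arbitrary: g)
    case 0
    then show ?case using cont by simp
  next
    case (Suc k)
    obtain g' where g': "g' \<in> G" "\<And>t. (g has_real_derivative g' t) (at t)"
      using assms(1)[OF Suc.prems] by blast
    have eq: "(\<lambda>t. g ((x(j := t)) i)) = (if i = j then g else (\<lambda>t. g (x i)))"
      for j and x :: "nat \<Rightarrow> real" by auto
    have "C_diff n k (partial_deriv n j (\<lambda>x. g (x i)))" if "j < n" for j
    proof -
      have "C_diff n k (\<lambda>x. if i = j then g' (x i) else 0)"
        using Suc.IH[OF g'(1)] by (cases "i = j") (simp_all add: C_diff_const)
      moreover have "partial_deriv n j (\<lambda>x. g (x i)) x = (if i = j then g' (x i) else 0)"
        if "x \<in> euclid n" for x
        using that g'(2) unfolding partial_deriv_def eq by (auto intro: DERIV_imp_deriv)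
      ultimately show ?thesis by (subst C_diff_cong) auto
    qed
    moreover have "(\<lambda>t. g ((x(j := t)) i)) field_differentiable at (x j)" for j and x :: "nat \<Rightarrow> real"
      unfolding eq using g'(2) by (cases "i = j") (auto simp: field_differentiable_def intro: DERIV_const)
    ultimately show ?case using cont[OF Suc.prems] by simp
  qed
qed

lemma C_diff_flat: "C_diff n k (\<lambda>x. flat p (m * x i + b))"
proof (rule C_diff_univariate[of "range (\<lambda>p t. flat p (m * t + b))" "\<lambda>t. flat p (m * t + b)"])
  fix g assume "g \<in> range (\<lambda>p t. flat p (m * t + b))"
  then obtain p where g: "g = (\<lambda>t. flat p (m * t + b))" by blast
  have "(g has_real_derivative flat (flat_deriv p) (m * t + b) * m) (at t)" for t
    unfolding g by (rule DERIV_chain2[OF flat_has_derivative]) (auto intro!: derivative_eq_intros)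
  moreover have "flat (flat_deriv p) s * m = flat (smult m (flat_deriv p)) s" for s
    by (simp add: flat_def)
  ultimately show "\<exists>g'\<in>range (\<lambda>p t. flat p (m * t + b)). \<forall>t. (g has_real_derivative g' t) (at t)"
    by auto
qed auto

text \<open>
  By \<open>(1/f)' = - f' (1/f) (1/f)\<close>, a derivative of \<open>1/f\<close> is a product of \<open>f'\<close> with copies of \<open>1/f\<close> itself,
  so that differentiability of order \<open>k + 1\<close> follows from that of order \<open>k\<close>.
\<close>

lemma C_diff_inverse:
  assumes "C_diff n k f" and nz: "\<And>x. x \<in> euclid n \<Longrightarrow> f x \<noteq> 0"
  shows "C_diff n k (\<lambda>x. inverse (f x))"
  using assms(1)
proof (induction k)
  case 0
  then show ?case using nz by (auto intro: continuous_on_inverse)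
next
  case (Suc k)
  have IH: "C_diff n k (\<lambda>x. inverse (f x))"
    using Suc C_diff_Suc_D by blast
  have d: "(\<lambda>t. f (x(i := t))) field_differentiable at (x i)" "f (x(i := x i)) \<noteq> 0"
    if "x \<in> euclid n" "i < n" for x i
    using Suc.prems nz that by auto
  have "C_diff n k (partial_deriv n i (\<lambda>x. inverse (f x)))" if i: "i < n" for i
  proof -
    have "C_diff n k (\<lambda>x. (- 1) * (partial_deriv n i f x * (inverse (f x) * inverse (f x))))"
      using Suc.prems i IH by (intro C_diff_mult C_diff_const) auto
    moreover have "partial_deriv n i (\<lambda>x. inverse (f x)) x
        = (- 1) * (partial_deriv n i f x * (inverse (f x) * inverse (f x)))"
      if "x \<in> euclid n" for x
      using DERIV_inverse_fun[of "\<lambda>t. f (x(i := t))", OF field_differentiable_derivI, OF d[OF that i]] that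
      by (auto simp: partial_deriv_def power2_eq_square field_simps intro!: DERIV_imp_deriv)
    ultimately show ?thesis by (subst C_diff_cong) auto
  qed
  moreover have "(\<lambda>t. inverse (f (x(i := t)))) field_differentiable at (x i)"
    if "x \<in> euclid n" "i < n" for x i
    using field_differentiable_inverse[OF d[OF that]] .
  moreover have "continuous_on (euclid n) (\<lambda>x. inverse (f x))"
    using Suc.prems nz by (auto intro: continuous_on_inverse)
  ultimately show ?case by simp
qed

text \<open>
  A smooth function stays smooth when a dummy variable is put in front of its arguments. The new
  variable will be the one that an idempotent is substituted for.
\<close>

lemma C_diff_shift:
  assumes "C_diff n k f"
  shows "C_diff (Suc n) k (\<lambda>y. f (\<lambda>j\<in>{..<n}. y (Suc j)))"
proof -
  let ?s = "\<lambda>y::nat \<Rightarrow> real. \<lambda>j\<in>{..<n}. y (Suc j)"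
  have s: "?s y \<in> euclid n" for y by (auto simp: euclid_def)
  have "continuous_on (euclid (Suc n)) ?s"
  proof (rule continuous_on_coordinatewise_then_product)
    show "continuous_on (euclid (Suc n)) (\<lambda>y. ?s y j)" for j
      using continuous_on_coord by (cases "j < n") auto
  qed
  then have cont: "continuous_on (euclid (Suc n)) (\<lambda>y. f (?s y))"
    if "continuous_on (euclid n) f" for f :: "_ \<Rightarrow> real"
    by (rule continuous_on_compose2[OF that]) (use s in auto)
  have upd: "?s (y(0 := t)) = ?s y" "?s (y(Suc i := t)) = (if i < n then (?s y)(i := t) else ?s y)" for y t i
    by auto
  show ?thesis using assms
  proof (induction k arbitrary: f)
    case 0
    then show ?case using cont[of f] by (simp only: C_diff.simps)
  next
    case (Suc k)
    have fd: "(\<lambda>t. f ((?s y)(l := t))) field_differentiable at (y (Suc l))" if "l < n" for l y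
    proof -
      have "(\<lambda>t. f ((?s y)(l := t))) field_differentiable at (?s y l)"
        using Suc.prems s[of y] that unfolding C_diff.simps by blast
      moreover have "?s y l = y (Suc l)" using that by simp
      ultimately show ?thesis by (simp only:)
    qed
    have IH: "C_diff (Suc n) k (\<lambda>y. partial_deriv n l f (?s y))" if "l < n" for l
      by (rule Suc.IH) (use Suc.prems that in simp)
    have "C_diff (Suc n) k (partial_deriv (Suc n) i (\<lambda>y. f (?s y)))" if i: "i < Suc n" for i
    proof (cases i)
      case 0
      then show ?thesis
        by (subst C_diff_cong[of _ _ "\<lambda>_. 0"]) (simp_all add: partial_deriv_def upd C_diff_const)
    next
      case (Suc l)
      then have "l < n" using i by simp
      then have "C_diff (Suc n) k (\<lambda>y. partial_deriv n l f (?s y))"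
        by (rule IH)
      moreover have "partial_deriv (Suc n) i (\<lambda>y. f (?s y)) y = partial_deriv n l f (?s y)"
        if "y \<in> euclid (Suc n)" for y
        using that \<open>l < n\<close> s[of y] unfolding Suc partial_deriv_def upd by simp
      ultimately show ?thesis by (subst C_diff_cong) auto
    qed
    moreover have "(\<lambda>t. f (?s (y(i := t)))) field_differentiable at (y i)" if "i < Suc n" for y i
    proof (cases i)
      case (Suc l)
      then show ?thesis using fd[of l y] that unfolding Suc upd by simp
    qed (simp add: upd)
    ultimately show ?case using cont[of f] Suc.prems unfolding C_diff.simps by blast
  qed
qed

text \<open>
  The function \<open>t a(t)\<close> is a smooth step: it is 0 up to \<open>c\<close> and 1 from \<open>d\<close> on. The point is that the
  step is delivered together with its quotient by \<open>t\<close>, and its complement \<open>(1 - t) b(t)\<close> together with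
  the quotient by \<open>1 - t\<close>. These two factorizations alone fix the value of the step at an idempotent
  of any C-infinity-ring, without Hadamard's lemma.
\<close>

lemma ex_smooth_step_quotients:
  fixes c d :: real
  assumes "0 < c" "c < d" "d < 1"
  obtains a b :: "real \<Rightarrow> real" where
    "\<And>n k i. C_diff n k (\<lambda>x. a (x i))" "\<And>n k i. C_diff n k (\<lambda>x. b (x i))"
    "\<And>t. t * a t + (1 - t) * b t = 1" "\<And>t. t \<le> c \<Longrightarrow> a t = 0" "\<And>t. d \<le> t \<Longrightarrow> b t = 0"
proof
  \<comment> \<open>The denominator is positive: as \<open>c < d\<close>, one of its two summands is positive at every \<open>t\<close>.\<close>
  define D where "D = (\<lambda>t. t * flat 1 (t - c) + (1 - t) * flat 1 (d - t))"
  have D: "D t \<noteq> 0" for t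
  proof -
    have "0 \<le> t * flat 1 (t - c)" "0 \<le> (1 - t) * flat 1 (d - t)"
      using assms by (auto simp: flat_def)
    moreover have "0 < t * flat 1 (t - c) \<or> 0 < (1 - t) * flat 1 (d - t)"
      using assms by (cases "c < t") (auto simp: flat_def)
    ultimately show ?thesis unfolding D_def by linarith
  qed
  have f1: "C_diff n k (\<lambda>x. flat 1 (x i - c))" and f2: "C_diff n k (\<lambda>x. flat 1 (d - x i))" for n k i
    using C_diff_flat[of n k 1 1 i "- c"] C_diff_flat[of n k 1 "-1" i d] by (simp_all)
  have f3: "C_diff n k (\<lambda>x. 1 - x i)" for n k i
    using C_diff_add[OF C_diff_const[of n k 1] C_diff_mult[OF C_diff_const[of n k "-1"] C_diff_coord[of n k i]]]
    by simp
  have "C_diff n k (\<lambda>x. inverse (D (x i)))" for n k i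
    using D unfolding D_def by (intro C_diff_inverse C_diff_add C_diff_mult C_diff_coord f1 f2 f3)
  then show "C_diff n k (\<lambda>x. flat 1 (x i - c) * inverse (D (x i)))"
      "C_diff n k (\<lambda>x. flat 1 (d - x i) * inverse (D (x i)))" for n k i
    by (intro C_diff_mult f1 f2; simp)+
  have "D t * inverse (D t) = 1" for t using D by simp
  then show "t * (flat 1 (t - c) * inverse (D t)) + (1 - t) * (flat 1 (d - t) * inverse (D t)) = 1" for t
    by (metis D_def distrib_right mult.assoc)
qed (auto simp: flat_def)

section \<open>Smooth operations and idempotents\<close>

text \<open>
  Write \<open>e\<close> for the idempotent, \<open>w = 1 - e\<close>, and \<open>\<alpha>\<close>, \<open>\<beta>\<close> for the values of \<open>a\<close>, \<open>b\<close> at \<open>e\<close>. Then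
  \<open>e \<alpha> + w \<beta> = 1\<close>; multiplying by \<open>e\<close> kills the second summand and leaves \<open>e \<alpha> = e\<close>.
\<close>

lemma opn_step_at_idempotent:
  assumes B: "cinf_ring B" and v: "v \<in> tuples B n" and i: "i < n"
    and idem: "v i \<otimes>\<^bsub>underlying_ring B\<^esub> v i = v i"
    and a: "\<And>k. C_diff n k (\<lambda>x. a (x i))" and b: "\<And>k. C_diff n k (\<lambda>x. b (x i))"
    and ab: "\<And>t. t * a t + (1 - t) * b t = 1"
  shows "opn B n (\<lambda>x\<in>euclid n. x i * a (x i)) v = v i"
proof -
  let ?R = "underlying_ring B"
  interpret cring ?R by (rule underlying_cring[OF B])
  let ?X = "coord n i" and ?W = "add_smooth n (const_smooth n 1) (mult_smooth n (const_smooth n (-1)) (coord n i))"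
  let ?a = "\<lambda>x\<in>euclid n. a (x i)" and ?b = "\<lambda>x\<in>euclid n. b (x i)"
  have sm: "?X \<in> smooth n" "?W \<in> smooth n" "?a \<in> smooth n" "?b \<in> smooth n"
    by (intro smooth_intros smooth_restrict a b)+
  have W: "?W x = 1 - x i" if "x \<in> euclid n" for x
    using that by (simp add: add_smooth_def mult_smooth_def const_smooth_def coord_def)
  have sum_one: "add_smooth n p q = const_smooth n 1" if "\<And>x. x \<in> euclid n \<Longrightarrow> p x + q x = 1" for p q
    unfolding add_smooth_def const_smooth_def by (rule restrict_ext) (rule that)
  have mult_val: "mult_smooth n p q x = p x * q x" if "x \<in> euclid n" for p q x
    using that by (simp add: mult_smooth_def)
  have X: "?X x = x i" if "x \<in> euclid n" for x
    using that by (simp add: coord_def)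
  have eqs: "(\<lambda>x\<in>euclid n. x i * a (x i)) = mult_smooth n ?X ?a"
    "add_smooth n (mult_smooth n ?X ?a) (mult_smooth n ?W ?b) = const_smooth n 1"
    "add_smooth n ?W ?X = const_smooth n 1"
  proof -
    show "(\<lambda>x\<in>euclid n. x i * a (x i)) = mult_smooth n ?X ?a"
      unfolding mult_smooth_def by (rule restrict_ext) (simp add: X)
  qed (rule sum_one; simp add: mult_val W X ab)+
  define e w \<alpha> \<beta> where "e = v i" and "w = opn B n ?W v" and "\<alpha> = opn B n ?a v" and "\<beta> = opn B n ?b v"
  have e: "e = opn B n ?X v" using cinf_ring_coord[OF B i v] by (simp add: e_def)
  have cl: "e \<in> carrier ?R" "w \<in> carrier ?R" "\<alpha> \<in> carrier ?R" "\<beta> \<in> carrier ?R"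
    using cinf_ring_closed[OF B _ v] sm by (simp_all add: e w_def \<alpha>_def \<beta>_def)
  have ee: "e \<otimes>\<^bsub>?R\<^esub> e = e" using idem by (simp add: e_def)
  have 1: "e \<otimes>\<^bsub>?R\<^esub> \<alpha> \<oplus>\<^bsub>?R\<^esub> w \<otimes>\<^bsub>?R\<^esub> \<beta> = \<one>\<^bsub>?R\<^esub>"
    using arg_cong[OF eqs(2), of "\<lambda>f. opn B n f v"] sm
    by (simp add: opn_add[OF B _ _ v] opn_mult[OF B _ _ v] opn_one[OF B v] mult_smooth e w_def \<alpha>_def \<beta>_def)
  have 2: "w \<oplus>\<^bsub>?R\<^esub> e = \<one>\<^bsub>?R\<^esub>"
    using arg_cong[OF eqs(3), of "\<lambda>f. opn B n f v"] sm
    by (simp add: opn_add[OF B _ _ v] opn_one[OF B v] e w_def)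
  have "e = e \<otimes>\<^bsub>?R\<^esub> (w \<oplus>\<^bsub>?R\<^esub> e)" using cl 2 by simp
  also have "\<dots> = e \<otimes>\<^bsub>?R\<^esub> w \<oplus>\<^bsub>?R\<^esub> e" using cl ee by (simp add: r_distr)
  finally have "\<zero>\<^bsub>?R\<^esub> \<oplus>\<^bsub>?R\<^esub> e = e \<otimes>\<^bsub>?R\<^esub> w \<oplus>\<^bsub>?R\<^esub> e" using cl by simp
  then have ew: "e \<otimes>\<^bsub>?R\<^esub> w = \<zero>\<^bsub>?R\<^esub>"
    using cl by (metis add.right_cancel m_closed zero_closed)
  have "e = e \<otimes>\<^bsub>?R\<^esub> (e \<otimes>\<^bsub>?R\<^esub> \<alpha> \<oplus>\<^bsub>?R\<^esub> w \<otimes>\<^bsub>?R\<^esub> \<beta>)" using cl 1 by simp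
  also have "\<dots> = (e \<otimes>\<^bsub>?R\<^esub> e) \<otimes>\<^bsub>?R\<^esub> \<alpha> \<oplus>\<^bsub>?R\<^esub> (e \<otimes>\<^bsub>?R\<^esub> w) \<otimes>\<^bsub>?R\<^esub> \<beta>"
    using cl by (simp add: r_distr m_assoc del: underlying_ring_carrier)
  also have "\<dots> = e \<otimes>\<^bsub>?R\<^esub> \<alpha>" using cl ee ew by (simp del: underlying_ring_carrier)
  also have "\<dots> = opn B n (\<lambda>x\<in>euclid n. x i * a (x i)) v"
    unfolding eqs(1) using sm by (simp add: opn_mult[OF B _ _ v] e \<alpha>_def)
  finally show ?thesis by (simp add: e_def)
qed

text \<open>
  After multiplication by \<open>e\<close>, only the part of the arguments that lies over \<open>e\<close> counts. For polynomials
  \<open>f\<close> this is plain algebra.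
  For smooth \<open>f\<close>, take smooth steps \<open>\<chi>\<close> and \<open>\<chi>'\<close> such that \<open>\<chi>'\<close> is 1 wherever \<open>\<chi>\<close> is nonzero. Then
  \<open>\<chi>(t) f(x) = \<chi>(t) f(\<chi>'(t) x)\<close> holds identically on real space, hence in every C-infinity ring, and both
  steps take the value \<open>e\<close> at \<open>t = e\<close>.
\<close>

lemma opn_local_at_idempotent:
  assumes B: "cinf_ring B" and e: "e \<in> carrier B" "e \<otimes>\<^bsub>underlying_ring B\<^esub> e = e"
    and f: "f \<in> smooth n" and x: "x \<in> tuples B n"
  shows "e \<otimes>\<^bsub>underlying_ring B\<^esub> opn B n f x
    = e \<otimes>\<^bsub>underlying_ring B\<^esub> opn B n f (\<lambda>j\<in>{..<n}. e \<otimes>\<^bsub>underlying_ring B\<^esub> x j)"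
proof -
  let ?R = "underlying_ring B" and ?N = "Suc n"
  obtain a b where ab: "\<And>n k i. C_diff n k (\<lambda>x. a (x i))" "\<And>n k i. C_diff n k (\<lambda>x. b (x i))"
      "\<And>t::real. t * a t + (1 - t) * b t = 1" "\<And>t. t \<le> 1 / 2 \<Longrightarrow> a t = 0" "\<And>t. 3 / 4 \<le> t \<Longrightarrow> b t = 0"
    by (rule ex_smooth_step_quotients[of "1/2" "3/4"]) (simp, simp, simp, rule that, assumption+)
  obtain a' b' where ab': "\<And>n k i. C_diff n k (\<lambda>x. a' (x i))" "\<And>n k i. C_diff n k (\<lambda>x. b' (x i))"
      "\<And>t::real. t * a' t + (1 - t) * b' t = 1" "\<And>t. t \<le> 1 / 4 \<Longrightarrow> a' t = 0" "\<And>t. 1 / 2 \<le> t \<Longrightarrow> b' t = 0"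
    by (rule ex_smooth_step_quotients[of "1/4" "1/2"]) (simp, simp, simp, rule that, assumption+)
  have st: "t * a' t = 1" if "1 / 2 \<le> t" for t
    using ab'(3)[of t] ab'(5)[OF that] by simp
  \<comment> \<open>\<open>X\<close> rises between 1/2 and 3/4, \<open>Y\<close> between 1/4 and 1/2.\<close>
  let ?X = "\<lambda>y\<in>euclid ?N. y 0 * a (y 0)" and ?Y = "\<lambda>y\<in>euclid ?N. y 0 * a' (y 0)"
  let ?F = "\<lambda>y\<in>euclid ?N. f (\<lambda>j\<in>{..<n}. y (Suc j))"
  have XY: "?X \<in> smooth ?N" "?Y \<in> smooth ?N"
    by (rule smooth_restrict, intro C_diff_mult C_diff_coord ab ab')+
  have F: "?F \<in> smooth ?N"
    using f by (intro smooth_restrict C_diff_shift) (simp add: smooth_def)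
  \<comment> \<open>Both sides of the identity are the one smooth function \<open>P(s, y) = s f(y)\<close> with smooth functions
    substituted for its arguments, so a single instance of the composition law evaluates each side.\<close>
  define P where "P = mult_smooth ?N (coord ?N 0) ?F"
  have P: "P \<in> smooth ?N" unfolding P_def by (intro smooth_intros F)
  have F_comp: "?F = comp_smooth ?N n f (\<lambda>j. coord ?N (Suc j))"
    unfolding comp_smooth_def coord_def by (rule restrict_ext) (auto intro!: arg_cong[of _ _ f])
  have opn_P: "opn B ?N P w = w 0 \<otimes>\<^bsub>?R\<^esub> opn B n f (\<lambda>j\<in>{..<n}. w (Suc j))" if w: "w \<in> tuples B ?N" for w
  proof -
    have "opn B ?N ?F w = opn B n f (\<lambda>j\<in>{..<n}. opn B ?N (coord ?N (Suc j)) w)"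
      unfolding F_comp by (rule cinf_ring_comp[OF B f coord_smooth w])
    also have "(\<lambda>j\<in>{..<n}. opn B ?N (coord ?N (Suc j)) w) = (\<lambda>j\<in>{..<n}. w (Suc j))"
      by (rule restrict_ext) (simp add: cinf_ring_coord[OF B _ w])
    finally show ?thesis
      unfolding P_def opn_mult[OF B coord_smooth F w] by (simp only: cinf_ring_coord[OF B zero_less_Suc w])
  qed
  let ?g = "\<lambda>j. if j = 0 then ?X else coord ?N j"
  let ?h = "\<lambda>j. if j = 0 then ?X else mult_smooth ?N ?Y (coord ?N j)"
  have eq: "comp_smooth ?N ?N P ?g = comp_smooth ?N ?N P ?h"
    unfolding comp_smooth_def
  proof (rule restrict_ext)
    fix y assume y: "y \<in> euclid ?N"
    have eu: "(\<lambda>j\<in>{..<?N}. k j y) \<in> euclid ?N" for k :: "nat \<Rightarrow> (nat \<Rightarrow> real) \<Rightarrow> real"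
      by (auto simp: euclid_def)
    have P_eq: "P (\<lambda>j\<in>{..<?N}. k j y) = k 0 y * f (\<lambda>j\<in>{..<n}. k (Suc j) y)"
      for k :: "nat \<Rightarrow> (nat \<Rightarrow> real) \<Rightarrow> real"
    proof -
      have "(\<lambda>j\<in>{..<n}. (\<lambda>j\<in>{..<?N}. k j y) (Suc j)) = (\<lambda>j\<in>{..<n}. k (Suc j) y)"
        by (rule restrict_ext) simp
      then show ?thesis unfolding P_def mult_smooth_def coord_def using eu[of k] by simp
    qed
    have "(if (0::nat) = 0 then ?X else p) = ?X" "(if Suc j = 0 then ?X else p) = p" for p j by simp_all
    note if_eq = this
    show "P (\<lambda>j\<in>{..<?N}. ?g j y) = P (\<lambda>j\<in>{..<?N}. ?h j y)"
      unfolding P_eq[of ?g] P_eq[of ?h] if_eq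
    proof (cases "y 0 \<le> 1 / 2")
      case True
      then have "?X y = 0" using ab(4) y by simp
      then show "?X y * f (\<lambda>j\<in>{..<n}. coord ?N (Suc j) y)
          = ?X y * f (\<lambda>j\<in>{..<n}. mult_smooth ?N ?Y (coord ?N (Suc j)) y)"
        by (simp only: mult_zero_left)
    next
      case False
      then have "(\<lambda>j\<in>{..<n}. coord ?N (Suc j) y) = (\<lambda>j\<in>{..<n}. mult_smooth ?N ?Y (coord ?N (Suc j)) y)"
        using st[of "y 0"] y by (intro restrict_ext) (simp add: mult_smooth_def)
      then show "?X y * f (\<lambda>j\<in>{..<n}. coord ?N (Suc j) y)
          = ?X y * f (\<lambda>j\<in>{..<n}. mult_smooth ?N ?Y (coord ?N (Suc j)) y)"
        by (simp only:)
    qed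
  qed
  define v where "v = (\<lambda>j\<in>{..<?N}. case j of 0 \<Rightarrow> e | Suc j \<Rightarrow> x j)"
  have v: "v \<in> tuples B ?N"
    unfolding tuples_def v_def
  proof (rule restrict_PiE_iff[THEN iffD2], rule ballI)
    fix j assume "j \<in> {..<?N}"
    then show "(case j of 0 \<Rightarrow> e | Suc j \<Rightarrow> x j) \<in> carrier B"
      using e(1) x by (cases j) (auto simp: tuples_def)
  qed
  have v0: "v 0 = e" and vS: "\<And>j. j < n \<Longrightarrow> v (Suc j) = x j" by (simp_all add: v_def)
  have vv: "v 0 \<otimes>\<^bsub>?R\<^esub> v 0 = v 0" unfolding v0 by (rule e(2))
  have X: "opn B ?N ?X v = e"
    using opn_step_at_idempotent[of B v ?N 0 a b, OF B v zero_less_Suc vv ab(1,2,3)] unfolding v0 .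
  have Y: "opn B ?N ?Y v = e"
    using opn_step_at_idempotent[of B v ?N 0 a' b', OF B v zero_less_Suc vv ab'(1,2,3)] unfolding v0 .
  have comp_val: "opn B ?N (comp_smooth ?N ?N P k) v
      = opn B ?N (k 0) v \<otimes>\<^bsub>?R\<^esub> opn B n f (\<lambda>j\<in>{..<n}. opn B ?N (k (Suc j)) v)"
    if k: "\<And>j. k j \<in> smooth ?N" for k
  proof -
    have "(\<lambda>j\<in>{..<?N}. opn B ?N (k j) v) \<in> tuples B ?N"
      using cinf_ring_closed[OF B k v] by (auto simp: tuples_def)
    moreover have "(\<lambda>j\<in>{..<n}. (\<lambda>j\<in>{..<?N}. opn B ?N (k j) v) (Suc j)) = (\<lambda>j\<in>{..<n}. opn B ?N (k (Suc j)) v)"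
      by (rule restrict_ext) simp
    ultimately show ?thesis
      unfolding cinf_ring_comp[OF B P k v] by (subst opn_P) simp_all
  qed
  have "x = (\<lambda>j\<in>{..<n}. opn B ?N (coord ?N (Suc j)) v)"
    using x by (auto simp: cinf_ring_coord[OF B _ v] vS tuples_def PiE_def extensional_def fun_eq_iff)
  then have "e \<otimes>\<^bsub>?R\<^esub> opn B n f x = opn B ?N (comp_smooth ?N ?N P ?g) v"
    using comp_val[of ?g] XY coord_smooth by (simp add: X)
  also have "\<dots> = e \<otimes>\<^bsub>?R\<^esub> opn B n f (\<lambda>j\<in>{..<n}. opn B ?N (mult_smooth ?N ?Y (coord ?N (Suc j))) v)"
    unfolding eq using comp_val[of ?h] XY coord_smooth by (simp add: X mult_smooth)
  also have "(\<lambda>j\<in>{..<n}. opn B ?N (mult_smooth ?N ?Y (coord ?N (Suc j))) v) = (\<lambda>j\<in>{..<n}. e \<otimes>\<^bsub>?R\<^esub> x j)"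
    by (rule restrict_ext) (simp add: opn_mult[OF B XY(2) coord_smooth v] Y cinf_ring_coord[OF B _ v] vS)
  finally show ?thesis .
qed

lemma opn_cong_at_idempotent:
  assumes B: "cinf_ring B" and e: "e \<in> carrier B" "e \<otimes>\<^bsub>underlying_ring B\<^esub> e = e"
    and f: "f \<in> smooth n" and x: "x \<in> tuples B n" and y: "y \<in> tuples B n"
    and xy: "\<And>j. j < n \<Longrightarrow> e \<otimes>\<^bsub>underlying_ring B\<^esub> x j = e \<otimes>\<^bsub>underlying_ring B\<^esub> y j"
  shows "e \<otimes>\<^bsub>underlying_ring B\<^esub> opn B n f x = e \<otimes>\<^bsub>underlying_ring B\<^esub> opn B n f y"
proof -
  have "(\<lambda>j\<in>{..<n}. e \<otimes>\<^bsub>underlying_ring B\<^esub> x j) = (\<lambda>j\<in>{..<n}. e \<otimes>\<^bsub>underlying_ring B\<^esub> y j)"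
    by (rule restrict_ext) (simp add: xy)
  then show ?thesis
    using opn_local_at_idempotent[OF B e f x] opn_local_at_idempotent[OF B e f y] by simp
qed

text \<open>
  The factor of \<open>B\<close> cut out by an idempotent \<open>e\<close>, realized as the ideal \<open>e B\<close> with unit \<open>e\<close>. It is also
  the localization of \<open>B\<close> at \<open>e\<close>; as a subset of \<open>B\<close> it needs no new element type, and elements of
  different corners can be added.
\<close>

definition corner :: "'a cinf \<Rightarrow> 'a \<Rightarrow> 'a cinf" where
  "corner B e =
     \<lparr> carrier = {b \<in> carrier B. e \<otimes>\<^bsub>underlying_ring B\<^esub> b = b},
       opn = (\<lambda>n f b. e \<otimes>\<^bsub>underlying_ring B\<^esub> opn B n f b) \<rparr>"

lemma corner_opn: "opn (corner B e) n f b = e \<otimes>\<^bsub>underlying_ring B\<^esub> opn B n f b"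
  by (simp add: corner_def)

lemma corner_tuples: "b \<in> tuples (corner B e) n \<Longrightarrow> b \<in> tuples B n"
  by (auto simp: tuples_def corner_def)

text \<open>
  Only the composition law has content: the inner operations are multiplied by \<open>e\<close> and the outer one
  must not notice, which is the congruence at an idempotent.
\<close>

lemma cinf_ring_corner:
  assumes B: "cinf_ring B" and e: "e \<in> carrier B" "e \<otimes>\<^bsub>underlying_ring B\<^esub> e = e"
  shows "cinf_ring (corner B e)"
  unfolding cinf_ring_def
proof (intro conjI allI ballI impI)
  let ?R = "underlying_ring B"
  interpret cring ?R by (rule underlying_cring[OF B])
  have ee: "e \<otimes>\<^bsub>?R\<^esub> (e \<otimes>\<^bsub>?R\<^esub> b) = e \<otimes>\<^bsub>?R\<^esub> b" if "b \<in> carrier B" for b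
    using that e m_assoc[of e e b] by simp
  fix n f b assume f: "f \<in> smooth n" and b: "b \<in> tuples (corner B e) n"
  show "opn (corner B e) n f b \<in> carrier (corner B e)"
    using cinf_ring_closed[OF B f corner_tuples[OF b]] e m_closed
    by (simp add: corner_def ee)
next
  fix n i b assume i: "i < n" and b: "b \<in> tuples (corner B e) n"
  have "b i \<in> carrier (corner B e)" using i b by (auto simp: tuples_def)
  then show "opn (corner B e) n (coord n i) b = b i"
    using cinf_ring_coord[OF B i corner_tuples[OF b]] by (simp add: corner_def)
next
  let ?R = "underlying_ring B"
  interpret cring ?R by (rule underlying_cring[OF B])
  fix n m f g b assume f: "f \<in> smooth m" and g: "\<forall>j<m. g j \<in> smooth n" and b: "b \<in> tuples (corner B e) n"
  note b' = corner_tuples[OF b]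
  have c: "opn B n (g j) b \<in> carrier B" if "j < m" for j
    using g that cinf_ring_closed[OF B _ b'] by blast
  have "e \<otimes>\<^bsub>?R\<^esub> opn B m f (\<lambda>j\<in>{..<m}. opn B n (g j) b)
      = e \<otimes>\<^bsub>?R\<^esub> opn B m f (\<lambda>j\<in>{..<m}. e \<otimes>\<^bsub>?R\<^esub> opn B n (g j) b)"
  proof (rule opn_cong_at_idempotent[OF B e f])
    fix j assume "j < m"
    then show "e \<otimes>\<^bsub>?R\<^esub> (\<lambda>j\<in>{..<m}. opn B n (g j) b) j
        = e \<otimes>\<^bsub>?R\<^esub> (\<lambda>j\<in>{..<m}. e \<otimes>\<^bsub>?R\<^esub> opn B n (g j) b) j"
      using c[of j] e m_assoc[of e e "opn B n (g j) b"] by simp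
  qed (use c e m_closed in \<open>auto simp: tuples_def\<close>)
  then show "opn (corner B e) n (comp_smooth n m f g) b
      = opn (corner B e) m f (\<lambda>j\<in>{..<m}. opn (corner B e) n (g j) b)"
    using cinf_ring_comp[OF B f _ b'] g by (simp add: corner_def)
qed

lemma corner_mult:
  assumes B: "cinf_ring B" and e: "e \<in> carrier B"
    and ab: "a \<in> carrier (corner B e)" "b \<in> carrier (corner B e)"
  shows "a \<otimes>\<^bsub>underlying_ring (corner B e)\<^esub> b = a \<otimes>\<^bsub>underlying_ring B\<^esub> b"
proof -
  let ?R = "underlying_ring B"
  interpret cring ?R by (rule underlying_cring[OF B])
  have "a \<otimes>\<^bsub>underlying_ring (corner B e)\<^esub> b = e \<otimes>\<^bsub>?R\<^esub> (a \<otimes>\<^bsub>?R\<^esub> b)"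
    by (simp add: underlying_ring_def corner_def)
  also have "\<dots> = a \<otimes>\<^bsub>?R\<^esub> b"
    using ab e m_assoc[of e a b] by (simp add: corner_def)
  finally show ?thesis .
qed

lemma vn_regular_corner:
  assumes B: "vn_regular_cinf_ring B" and e: "e \<in> carrier B" "e \<otimes>\<^bsub>underlying_ring B\<^esub> e = e"
  shows "vn_regular_cinf_ring (corner B e)"
proof -
  let ?R = "underlying_ring B" and ?C = "underlying_ring (corner B e)"
  have B': "cinf_ring B" using B by (simp add: vn_regular_cinf_ring_def)
  have C: "cinf_ring (corner B e)" by (rule cinf_ring_corner[OF B' e])
  interpret cring ?R by (rule underlying_cring[OF B'])
  interpret C: cring ?C by (rule underlying_cring[OF C])
  have "\<exists>x\<in>carrier ?C. a = a [^]\<^bsub>?C\<^esub> (2::nat) \<otimes>\<^bsub>?C\<^esub> x" if a: "a \<in> carrier ?C" for a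
  proof -
    have aB: "a \<in> carrier B" "e \<otimes>\<^bsub>?R\<^esub> a = a" using a by (auto simp: corner_def)
    then obtain x where x: "x \<in> carrier B" "a = a \<otimes>\<^bsub>?R\<^esub> a \<otimes>\<^bsub>?R\<^esub> x"
      using B square by (auto simp: vn_regular_cinf_ring_def von_neumann_regular_def)
    \<comment> \<open>A witness of regularity in \<open>B\<close> is moved into the corner by multiplication with \<open>e\<close>.\<close>
    have ex: "e \<otimes>\<^bsub>?R\<^esub> x \<in> carrier (corner B e)"
      using x e m_closed m_assoc[of e e x] by (simp add: corner_def)
    have "a = a \<otimes>\<^bsub>?R\<^esub> a \<otimes>\<^bsub>?R\<^esub> (e \<otimes>\<^bsub>?R\<^esub> x)"
    proof -
      have "a \<otimes>\<^bsub>?R\<^esub> a \<otimes>\<^bsub>?R\<^esub> (e \<otimes>\<^bsub>?R\<^esub> x) = (e \<otimes>\<^bsub>?R\<^esub> a) \<otimes>\<^bsub>?R\<^esub> a \<otimes>\<^bsub>?R\<^esub> x"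
        using aB(1) x(1) e(1) by (simp add: m_ac flip: underlying_ring_carrier)
      then show ?thesis using aB(2) x(2) by simp
    qed
    also have "\<dots> = a \<otimes>\<^bsub>?C\<^esub> a \<otimes>\<^bsub>?C\<^esub> (e \<otimes>\<^bsub>?R\<^esub> x)"
      using C.m_closed[OF a a] a ex by (simp add: corner_mult[OF B' e(1)])
    finally show ?thesis using ex C.square[OF a] by auto
  qed
  then show ?thesis
    using C by (simp add: vn_regular_cinf_ring_def von_neumann_regular_def)
qed

section \<open>Homomorphisms as ring homomorphisms\<close>

lemma hom_add:
  assumes h: "h \<in> cinf_hom A B" and "a \<in> carrier A" "b \<in> carrier A"
  shows "h (a \<oplus>\<^bsub>underlying_ring A\<^esub> b) = h a \<oplus>\<^bsub>underlying_ring B\<^esub> h b"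
proof -
  have "h (opn A 2 (add_smooth 2 (coord 2 0) (coord 2 1)) (pair a b))
      = opn B 2 (add_smooth 2 (coord 2 0) (coord 2 1)) (\<lambda>j\<in>{..<2}. h (pair a b j))"
    by (intro hom_opn[OF h] smooth_intros pair_tuples assms)
  then show ?thesis by (simp add: underlying_ring_def pair_map)
qed

lemma hom_const:
  assumes h: "h \<in> cinf_hom A B"
  shows "h (opn A 0 (const_smooth 0 c) (\<lambda>_. undefined)) = opn B 0 (const_smooth 0 c) (\<lambda>_. undefined)"
proof -
  have "(\<lambda>_. undefined) \<in> tuples A 0" by (auto simp: tuples_def)
  moreover have "(\<lambda>j\<in>{..<0::nat}. h undefined) = (\<lambda>_. undefined)" by (simp add: restrict_def)
  ultimately show ?thesis using hom_opn[OF h const_smooth, of "\<lambda>_. undefined" 0 c] by simp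
qed

lemma hom_one: "h \<in> cinf_hom A B \<Longrightarrow> h \<one>\<^bsub>underlying_ring A\<^esub> = \<one>\<^bsub>underlying_ring B\<^esub>"
  and hom_zero: "h \<in> cinf_hom A B \<Longrightarrow> h \<zero>\<^bsub>underlying_ring A\<^esub> = \<zero>\<^bsub>underlying_ring B\<^esub>"
  by (simp_all add: underlying_ring_def hom_const)

lemma hom_ring_hom_cring:
  assumes "cinf_ring A" "cinf_ring B" "h \<in> cinf_hom A B"
  shows "ring_hom_cring (underlying_ring A) (underlying_ring B) h"
proof -
  have "h \<in> ring_hom (underlying_ring A) (underlying_ring B)"
    by (rule ring_hom_memI) (use assms in \<open>simp_all add: hom_closed hom_mult hom_add hom_one\<close>)
  then show ?thesis
    using underlying_cring[OF assms(1)] underlying_cring[OF assms(2)]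
    by (simp add: ring_hom_cring_def ring_hom_cring_axioms_def)
qed

section \<open>Products of C-infinity rings\<close>

lemma prod_carrier [simp]: "carrier (cinf_prod I A) = (\<Pi>\<^sub>E i\<in>I. carrier (A i))"
  by (simp add: cinf_prod_def)

lemma prod_opn: "opn (cinf_prod I A) n f a = (\<lambda>i\<in>I. opn (A i) n f (\<lambda>j\<in>{..<n}. a j i))"
  by (simp add: cinf_prod_def)

lemma prod_tuples_component:
  assumes "a \<in> tuples (cinf_prod I A) n" "i \<in> I"
  shows "(\<lambda>j\<in>{..<n}. a j i) \<in> tuples (A i) n"
proof -
  have "a j i \<in> carrier (A i)" if "j < n" for j
    using assms that by (auto simp: tuples_def)
  then show ?thesis by (auto simp: tuples_def)
qed

lemma cinf_ring_prod:
  assumes A: "\<And>i. i \<in> I \<Longrightarrow> cinf_ring (A i)"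
  shows "cinf_ring (cinf_prod I A)"
  unfolding cinf_ring_def
proof (intro conjI allI ballI impI)
  fix n f a assume f: "f \<in> smooth n" and a: "a \<in> tuples (cinf_prod I A) n"
  have "opn (A i) n f (\<lambda>j\<in>{..<n}. a j i) \<in> carrier (A i)" if "i \<in> I" for i
    using cinf_ring_closed[OF A[OF that] f prod_tuples_component[OF a that]] .
  then show "opn (cinf_prod I A) n f a \<in> carrier (cinf_prod I A)"
    by (simp add: prod_opn)
next
  fix n k a assume k: "k < n" and a: "a \<in> tuples (cinf_prod I A) n"
  have ak: "a k \<in> (\<Pi>\<^sub>E i\<in>I. carrier (A i))" using a k by (auto simp: tuples_def)
  have "opn (A i) n (coord n k) (\<lambda>j\<in>{..<n}. a j i) = a k i" if "i \<in> I" for i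
    using cinf_ring_coord[OF A[OF that] k prod_tuples_component[OF a that]] k by simp
  then have "opn (cinf_prod I A) n (coord n k) a = restrict (a k) I"
    unfolding prod_opn by (intro restrict_ext)
  then show "opn (cinf_prod I A) n (coord n k) a = a k"
    using ak by (simp add: PiE_restrict)
next
  fix n m f g a
  assume f: "f \<in> smooth m" and g: "\<forall>j<m. g j \<in> smooth n" and a: "a \<in> tuples (cinf_prod I A) n"
  show "opn (cinf_prod I A) n (comp_smooth n m f g) a
      = opn (cinf_prod I A) m f (\<lambda>j\<in>{..<m}. opn (cinf_prod I A) n (g j) a)"
    unfolding prod_opn[of I A n "comp_smooth n m f g"] prod_opn[of I A m f]
  proof (rule restrict_ext)
    fix i assume i: "i \<in> I"
    have "(\<lambda>k\<in>{..<m}. (\<lambda>j\<in>{..<m}. opn (cinf_prod I A) n (g j) a) k i)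
        = (\<lambda>k\<in>{..<m}. opn (A i) n (g k) (\<lambda>j\<in>{..<n}. a j i))"
      using i by (intro restrict_ext) (simp add: prod_opn)
    then show "opn (A i) n (comp_smooth n m f g) (\<lambda>j\<in>{..<n}. a j i)
        = opn (A i) m f (\<lambda>k\<in>{..<m}. (\<lambda>j\<in>{..<m}. opn (cinf_prod I A) n (g j) a) k i)"
      using cinf_ring_comp[OF A[OF i] f _ prod_tuples_component[OF a i], of g] g by (simp only:)
  qed
qed

lemma prod_mult:
  "i \<in> I \<Longrightarrow> (x \<otimes>\<^bsub>underlying_ring (cinf_prod I A)\<^esub> y) i = x i \<otimes>\<^bsub>underlying_ring (A i)\<^esub> y i"
  using pair_map[of "\<lambda>z. z i" x y] by (simp add: underlying_ring_def prod_opn)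

lemma prod_const:
  "i \<in> I \<Longrightarrow> opn (cinf_prod I A) 0 f a i = opn (A i) 0 f (\<lambda>_. undefined)"
  by (simp add: prod_opn restrict_def)

lemma prod_one: "i \<in> I \<Longrightarrow> \<one>\<^bsub>underlying_ring (cinf_prod I A)\<^esub> i = \<one>\<^bsub>underlying_ring (A i)\<^esub>"
  and prod_zero: "i \<in> I \<Longrightarrow> \<zero>\<^bsub>underlying_ring (cinf_prod I A)\<^esub> i = \<zero>\<^bsub>underlying_ring (A i)\<^esub>"
  by (simp_all add: underlying_ring_def prod_const)

lemma vn_regular_prod:
  assumes A: "\<And>i. i \<in> I \<Longrightarrow> vn_regular_cinf_ring (A i)"
  shows "vn_regular_cinf_ring (cinf_prod I A)"
proof -
  let ?P = "underlying_ring (cinf_prod I A)"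
  have cA: "cinf_ring (A i)" if "i \<in> I" for i
    using A[OF that] by (simp add: vn_regular_cinf_ring_def)
  have cP: "cinf_ring (cinf_prod I A)" by (rule cinf_ring_prod[OF cA])
  interpret P: cring ?P by (rule underlying_cring[OF cP])
  have "\<exists>x\<in>carrier ?P. a = a [^]\<^bsub>?P\<^esub> (2::nat) \<otimes>\<^bsub>?P\<^esub> x" if a: "a \<in> carrier ?P" for a
  proof -
    have ai: "a i \<in> carrier (A i)" if "i \<in> I" for i using a that by auto
    have "\<exists>x. x \<in> carrier (A i) \<and> a i = a i \<otimes>\<^bsub>underlying_ring (A i)\<^esub> a i \<otimes>\<^bsub>underlying_ring (A i)\<^esub> x"
      if "i \<in> I" for i
      using A[OF that] ai[OF that] cring.square[OF underlying_cring[OF cA[OF that]]]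
      by (auto simp: vn_regular_cinf_ring_def von_neumann_regular_def)
    then obtain x where x: "\<And>i. i \<in> I \<Longrightarrow> x i \<in> carrier (A i)"
      "\<And>i. i \<in> I \<Longrightarrow> a i = a i \<otimes>\<^bsub>underlying_ring (A i)\<^esub> a i \<otimes>\<^bsub>underlying_ring (A i)\<^esub> x i"
      by metis
    have xP: "restrict x I \<in> carrier ?P" using x(1) by simp
    have "a = a \<otimes>\<^bsub>?P\<^esub> a \<otimes>\<^bsub>?P\<^esub> restrict x I"
    proof (rule PiE_ext)
      show "a \<in> (\<Pi>\<^sub>E i\<in>I. carrier (A i))" using a by simp
      show "a \<otimes>\<^bsub>?P\<^esub> a \<otimes>\<^bsub>?P\<^esub> restrict x I \<in> (\<Pi>\<^sub>E i\<in>I. carrier (A i))"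
        using P.m_closed[OF P.m_closed[OF a a] xP] by simp
    qed (use x(2) in \<open>simp add: prod_mult\<close>)
    then show ?thesis using xP P.square[OF a] by metis
  qed
  then show ?thesis
    using cP by (simp add: vn_regular_cinf_ring_def von_neumann_regular_def)
qed

lemma proj_hom:
  assumes A: "\<And>i. i \<in> I \<Longrightarrow> cinf_ring (A i)" and i: "i \<in> I"
  shows "cinf_proj I A i \<in> cinf_hom (cinf_prod I A) (A i)"
proof -
  have "cinf_proj I A i (opn (cinf_prod I A) n f a) = opn (A i) n f (\<lambda>j\<in>{..<n}. cinf_proj I A i (a j))"
    if f: "f \<in> smooth n" and a: "a \<in> tuples (cinf_prod I A) n" for n f a
  proof -
    have "cinf_proj I A i (opn (cinf_prod I A) n f a) = opn (A i) n f (\<lambda>j\<in>{..<n}. a j i)"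
      using cinf_ring_closed[OF cinf_ring_prod[OF A] f a] i by (simp add: cinf_proj_def prod_opn)
    also have "(\<lambda>j\<in>{..<n}. a j i) = (\<lambda>j\<in>{..<n}. cinf_proj I A i (a j))"
      using a by (intro restrict_ext) (auto simp: cinf_proj_def tuples_def)
    finally show ?thesis .
  qed
  moreover have "cinf_proj I A i \<in> carrier (cinf_prod I A) \<rightarrow>\<^sub>E carrier (A i)"
    using i by (auto simp: cinf_proj_def)
  ultimately show ?thesis by (simp add: cinf_hom_def)
qed

lemma tupling_hom:
  assumes B: "cinf_ring B" and h: "\<And>i. i \<in> I \<Longrightarrow> h i \<in> cinf_hom B (A i)"
  shows "tupling I B h \<in> cinf_hom B (cinf_prod I A)"
proof -
  have "tupling I B h (opn B n f b) = opn (cinf_prod I A) n f (\<lambda>j\<in>{..<n}. tupling I B h (b j))"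
    if f: "f \<in> smooth n" and b: "b \<in> tuples B n" for n f b
  proof -
    have "tupling I B h (opn B n f b) = (\<lambda>i\<in>I. h i (opn B n f b))"
      using cinf_ring_closed[OF B f b] by (simp add: tupling_def)
    also have "\<dots> = (\<lambda>i\<in>I. opn (A i) n f (\<lambda>k\<in>{..<n}. (\<lambda>j\<in>{..<n}. tupling I B h (b j)) k i))"
    proof (rule restrict_ext)
      fix i assume i: "i \<in> I"
      have "(\<lambda>k\<in>{..<n}. (\<lambda>j\<in>{..<n}. tupling I B h (b j)) k i) = (\<lambda>k\<in>{..<n}. h i (b k))"
        using i b by (intro restrict_ext) (auto simp: tupling_def tuples_def)
      then show "h i (opn B n f b) = opn (A i) n f (\<lambda>k\<in>{..<n}. (\<lambda>j\<in>{..<n}. tupling I B h (b j)) k i)"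
        using hom_opn[OF h[OF i] f b] by (simp only:)
    qed
    finally show ?thesis by (simp only: prod_opn)
  qed
  moreover have "tupling I B h \<in> carrier B \<rightarrow>\<^sub>E carrier (cinf_prod I A)"
    using hom_closed[OF h] by (auto simp: tupling_def)
  ultimately show ?thesis by (simp add: cinf_hom_def)
qed

lemma proj_tupling:
  assumes h: "\<And>i. i \<in> I \<Longrightarrow> h i \<in> cinf_hom B (A i)" and i: "i \<in> I"
  shows "compose (carrier B) (cinf_proj I A i) (tupling I B h) = h i"
proof
  fix b
  show "compose (carrier B) (cinf_proj I A i) (tupling I B h) b = h i b"
    using h[OF i] i hom_closed[OF h]
    by (cases "b \<in> carrier B") (auto simp: compose_def cinf_proj_def tupling_def cinf_hom_def PiE_def extensional_def)
qed

lemma tupling_proj: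
  assumes g: "g \<in> cinf_hom B (cinf_prod I A)"
  shows "tupling I B (\<lambda>i. compose (carrier B) (cinf_proj I A i) g) = g"
proof
  fix b
  show "tupling I B (\<lambda>i. compose (carrier B) (cinf_proj I A i) g) b = g b"
  proof (cases "b \<in> carrier B")
    case True
    then have "g b \<in> (\<Pi>\<^sub>E i\<in>I. carrier (A i))" using hom_closed[OF g] by simp
    then show ?thesis
      using True by (auto simp: tupling_def compose_def cinf_proj_def PiE_def extensional_def fun_eq_iff)
  next
    case False
    then show ?thesis using g by (auto simp: tupling_def cinf_hom_def PiE_def extensional_def)
  qed
qed

lemma prod_map_hom:
  assumes A: "\<And>i. i \<in> I \<Longrightarrow> cinf_ring (A i)" and h: "\<And>i. i \<in> I \<Longrightarrow> h i \<in> cinf_hom (A i) (B i)"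
  shows "prod_map I A h \<in> cinf_hom (cinf_prod I A) (cinf_prod I B)"
proof -
  let ?P = "cinf_prod I A"
  have P: "cinf_ring ?P" using A by (rule cinf_ring_prod)
  have "prod_map I A h = tupling I ?P (\<lambda>i. compose (carrier ?P) (h i) (cinf_proj I A i))"
    by (auto simp: prod_map_def tupling_def compose_def cinf_proj_def fun_eq_iff)
  moreover have "compose (carrier ?P) (h i) (cinf_proj I A i) \<in> cinf_hom ?P (B i)" if "i \<in> I" for i
    using A that by (intro hom_compose[OF P _ h[OF that]] proj_hom)
  ultimately show ?thesis using tupling_hom[OF P, of I _ B] by (simp only:)
qed

section \<open>Homomorphisms out of a finite product\<close>

definition axis_elem :: "'i set \<Rightarrow> ('i \<Rightarrow> 'a cinf) \<Rightarrow> 'i \<Rightarrow> 'a \<Rightarrow> 'i \<Rightarrow> 'a" where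
  "axis_elem I A i c = (\<lambda>k\<in>I. if k = i then c else \<zero>\<^bsub>underlying_ring (A k)\<^esub>)"

text \<open>
  Inclusion of a factor by zeros need not preserve operations that do not send zeros to 0, such as
  constants. It becomes a homomorphism once its values are regarded as elements of the corner of the
  product at this idempotent.
\<close>

definition prod_idem :: "'i set \<Rightarrow> ('i \<Rightarrow> 'a cinf) \<Rightarrow> 'i \<Rightarrow> 'i \<Rightarrow> 'a" where
  "prod_idem I A i = axis_elem I A i \<one>\<^bsub>underlying_ring (A i)\<^esub>"

context
  fixes I :: "'i set" and A :: "'i \<Rightarrow> 'a cinf"
  assumes A: "\<And>i. i \<in> I \<Longrightarrow> cinf_ring (A i)"
begin

lemmas prod_ring = cinf_ring_prod[of I A, OF A]

lemma factor_zero_closed: "i \<in> I \<Longrightarrow> \<zero>\<^bsub>underlying_ring (A i)\<^esub> \<in> carrier (A i)"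
  and factor_one_closed: "i \<in> I \<Longrightarrow> \<one>\<^bsub>underlying_ring (A i)\<^esub> \<in> carrier (A i)"
  using cring.cring_simprules(2,6)[OF underlying_cring[OF A]] by simp_all

lemma axis_elem_closed: "c \<in> carrier (A i) \<Longrightarrow> axis_elem I A i c \<in> carrier (cinf_prod I A)"
  by (auto simp: axis_elem_def factor_zero_closed)

lemma prod_idem_closed: "i \<in> I \<Longrightarrow> prod_idem I A i \<in> carrier (cinf_prod I A)"
  unfolding prod_idem_def by (intro axis_elem_closed factor_one_closed)

lemma prod_idem_mult:
  assumes i: "i \<in> I" and x: "x \<in> carrier (cinf_prod I A)"
  shows "prod_idem I A i \<otimes>\<^bsub>underlying_ring (cinf_prod I A)\<^esub> x = axis_elem I A i (x i)"
proof (rule PiE_ext)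
  interpret P: cring "underlying_ring (cinf_prod I A)"
    by (rule underlying_cring[OF prod_ring])
  show "prod_idem I A i \<otimes>\<^bsub>underlying_ring (cinf_prod I A)\<^esub> x \<in> (\<Pi>\<^sub>E i\<in>I. carrier (A i))"
    using P.m_closed[of "prod_idem I A i" x] prod_idem_closed[OF i] x by simp
  have "x i \<in> carrier (A i)" using i x by auto
  then show "axis_elem I A i (x i) \<in> (\<Pi>\<^sub>E i\<in>I. carrier (A i))"
    using axis_elem_closed by simp
  fix k assume k: "k \<in> I"
  interpret Ak: cring "underlying_ring (A k)" by (rule underlying_cring[OF A[OF k]])
  have "x k \<in> carrier (A k)" using k x by auto
  then show "(prod_idem I A i \<otimes>\<^bsub>underlying_ring (cinf_prod I A)\<^esub> x) k = axis_elem I A i (x i) k"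
    using k Ak.l_one[of "x k"] Ak.l_null[of "x k"] by (cases "k = i") (auto simp: prod_mult prod_idem_def axis_elem_def)
qed

lemma prod_idem_orthogonal:
  assumes "i \<in> I" "k \<in> I"
  shows "prod_idem I A i \<otimes>\<^bsub>underlying_ring (cinf_prod I A)\<^esub> prod_idem I A k
    = (if i = k then prod_idem I A i else \<zero>\<^bsub>underlying_ring (cinf_prod I A)\<^esub>)"
proof -
  interpret P: cring "underlying_ring (cinf_prod I A)"
    by (rule underlying_cring[OF prod_ring])
  have "axis_elem I A i \<zero>\<^bsub>underlying_ring (A i)\<^esub> = \<zero>\<^bsub>underlying_ring (cinf_prod I A)\<^esub>"
  proof (rule PiE_ext)
    show "axis_elem I A i \<zero>\<^bsub>underlying_ring (A i)\<^esub> \<in> (\<Pi>\<^sub>E i\<in>I. carrier (A i))"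
      using axis_elem_closed[OF factor_zero_closed[OF assms(1)]] by simp
    show "\<zero>\<^bsub>underlying_ring (cinf_prod I A)\<^esub> \<in> (\<Pi>\<^sub>E i\<in>I. carrier (A i))"
      using P.zero_closed by simp
  qed (simp add: axis_elem_def prod_zero)
  then show ?thesis
    using assms by (simp add: prod_idem_mult[OF assms(1) prod_idem_closed[OF assms(2)]])
      (simp add: prod_idem_def axis_elem_def)
qed

lemma sum_prod_idem:
  assumes I: "finite I"
  shows "(\<Oplus>\<^bsub>underlying_ring (cinf_prod I A)\<^esub>i\<in>I. prod_idem I A i) = \<one>\<^bsub>underlying_ring (cinf_prod I A)\<^esub>"
proof (rule PiE_ext)
  let ?P = "underlying_ring (cinf_prod I A)"
  interpret P: cring ?P by (rule underlying_cring[OF prod_ring])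
  have cl: "prod_idem I A \<in> I \<rightarrow> carrier ?P" using prod_idem_closed by simp
  show s: "(\<Oplus>\<^bsub>?P\<^esub>i\<in>I. prod_idem I A i) \<in> (\<Pi>\<^sub>E i\<in>I. carrier (A i))"
    using P.finsum_closed[OF cl] by simp
  show "\<one>\<^bsub>?P\<^esub> \<in> (\<Pi>\<^sub>E i\<in>I. carrier (A i))" using P.one_closed by simp
  fix k assume k: "k \<in> I"
  let ?R = "underlying_ring (A k)"
  interpret ring_hom_cring ?P ?R "cinf_proj I A k"
    by (rule hom_ring_hom_cring[OF prod_ring A[OF k] proj_hom[of I A, OF A k]])
  have "(\<Oplus>\<^bsub>?P\<^esub>i\<in>I. prod_idem I A i) k = cinf_proj I A k (\<Oplus>\<^bsub>?P\<^esub>i\<in>I. prod_idem I A i)"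
    using s by (simp add: cinf_proj_def del: hom_finsum)
  also have "\<dots> = (\<Oplus>\<^bsub>?R\<^esub>i\<in>I. (cinf_proj I A k \<circ> prod_idem I A) i)"
    by (rule hom_finsum[OF cl])
  also have "\<dots> = (\<Oplus>\<^bsub>?R\<^esub>i\<in>I. if k = i then \<one>\<^bsub>?R\<^esub> else \<zero>\<^bsub>?R\<^esub>)"
  proof (rule S.finsum_cong')
    fix i assume "i \<in> I"
    then show "(cinf_proj I A k \<circ> prod_idem I A) i = (if k = i then \<one>\<^bsub>?R\<^esub> else \<zero>\<^bsub>?R\<^esub>)"
      using prod_idem_closed[of i] k by (auto simp: cinf_proj_def prod_idem_def axis_elem_def)
  qed (auto simp del: underlying_ring_carrier)
  also have "\<dots> = \<one>\<^bsub>?R\<^esub>"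
    by (rule S.finsum_singleton[OF k I]) (auto simp del: underlying_ring_carrier)
  also have "\<dots> = \<one>\<^bsub>?P\<^esub> k" using k by (simp add: prod_one)
  finally show "(\<Oplus>\<^bsub>?P\<^esub>i\<in>I. prod_idem I A i) k = \<one>\<^bsub>?P\<^esub> k" .
qed

lemma axis_elem_opn:
  assumes i: "i \<in> I" and f: "f \<in> smooth n" and c: "c \<in> tuples (A i) n"
  shows "axis_elem I A i (opn (A i) n f c)
    = prod_idem I A i \<otimes>\<^bsub>underlying_ring (cinf_prod I A)\<^esub>
        opn (cinf_prod I A) n f (\<lambda>j\<in>{..<n}. axis_elem I A i (c j))"
proof -
  have t: "(\<lambda>j\<in>{..<n}. axis_elem I A i (c j)) \<in> tuples (cinf_prod I A) n"
  proof -
    have "axis_elem I A i (c j) \<in> carrier (cinf_prod I A)" if "j < n" for j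
      using c that by (intro axis_elem_closed) (auto simp: tuples_def)
    then show ?thesis by (auto simp: tuples_def simp del: prod_carrier)
  qed
  have "(\<lambda>k\<in>{..<n}. (\<lambda>j\<in>{..<n}. axis_elem I A i (c j)) k i) = restrict c {..<n}"
    using i by (intro restrict_ext) (simp add: axis_elem_def)
  also have "\<dots> = c" using c by (simp add: tuples_def PiE_restrict)
  finally have "opn (cinf_prod I A) n f (\<lambda>j\<in>{..<n}. axis_elem I A i (c j)) i = opn (A i) n f c"
    using i by (simp only: prod_opn restrict_apply if_True)
  then show ?thesis
    using prod_idem_mult[OF i cinf_ring_closed[OF prod_ring f t]] by (simp only:)
qed

text \<open>
  The next three lemmas say that homomorphisms from a finite product to \<open>B\<close> are the same as complete
  systems of orthogonal idempotents of \<open>B\<close> together with homomorphisms from the factors to their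
  corners.
\<close>

lemma hom_axis_corner:
  assumes g: "g \<in> cinf_hom (cinf_prod I A) B" and i: "i \<in> I"
  shows "(\<lambda>c\<in>carrier (A i). g (axis_elem I A i c)) \<in> cinf_hom (A i) (corner B (g (prod_idem I A i)))"
    (is "?k \<in> cinf_hom _ ?C")
proof -
  let ?P = "cinf_prod I A" and ?R = "underlying_ring B" and ?e = "g (prod_idem I A i)"
  have k_closed: "?k c \<in> carrier ?C" if c: "c \<in> carrier (A i)" for c
  proof -
    have x: "axis_elem I A i c \<in> carrier ?P" by (rule axis_elem_closed[OF c])
    have "axis_elem I A i (axis_elem I A i c i) = axis_elem I A i c"
      using i by (simp add: axis_elem_def)
    then have "?e \<otimes>\<^bsub>?R\<^esub> g (axis_elem I A i c) = g (axis_elem I A i c)"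
      using hom_mult[OF g prod_idem_closed[OF i] x] prod_idem_mult[OF i x] by simp
    then show ?thesis using c hom_closed[OF g x] by (simp add: corner_def)
  qed
  have "?k (opn (A i) n f c) = opn ?C n f (\<lambda>j\<in>{..<n}. ?k (c j))"
    if f: "f \<in> smooth n" and c: "c \<in> tuples (A i) n" for n f c
  proof -
    let ?t = "\<lambda>j\<in>{..<n}. axis_elem I A i (c j)"
    have cj: "c j \<in> carrier (A i)" if "j < n" for j using c that by (auto simp: tuples_def)
    have t: "?t \<in> tuples ?P n"
      using axis_elem_closed[OF cj] by (auto simp: tuples_def simp del: prod_carrier)
    have "?k (opn (A i) n f c) = g (axis_elem I A i (opn (A i) n f c))"
      using cinf_ring_closed[OF A[OF i] f c] by simp
    also have "\<dots> = ?e \<otimes>\<^bsub>?R\<^esub> g (opn ?P n f ?t)"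
      unfolding axis_elem_opn[OF i f c]
      by (rule hom_mult[OF g prod_idem_closed[OF i] cinf_ring_closed[OF prod_ring f t]])
    also have "g (opn ?P n f ?t) = opn B n f (\<lambda>j\<in>{..<n}. g (?t j))"
      by (rule hom_opn[OF g f t])
    also have "(\<lambda>j\<in>{..<n}. g (?t j)) = (\<lambda>j\<in>{..<n}. ?k (c j))"
      by (rule restrict_ext) (simp add: cj)
    finally show ?thesis unfolding corner_opn .
  qed
  moreover have "?k \<in> carrier (A i) \<rightarrow>\<^sub>E carrier ?C"
    using k_closed by (simp only: restrict_PiE_iff restrict_apply if_True) blast
  ultimately show ?thesis unfolding cinf_hom_def by blast
qed

lemma hom_eq_sum_axis:
  assumes I: "finite I" and B: "cinf_ring B" and g: "g \<in> cinf_hom (cinf_prod I A) B"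
    and x: "x \<in> carrier (cinf_prod I A)"
  shows "g x = (\<Oplus>\<^bsub>underlying_ring B\<^esub>i\<in>I. g (axis_elem I A i (x i)))"
proof -
  let ?P = "underlying_ring (cinf_prod I A)" and ?R = "underlying_ring B"
  note g_closed = hom_closed[OF g]
  interpret ring_hom_cring ?P ?R g
    by (rule hom_ring_hom_cring[OF prod_ring B g])
  have x': "x \<in> carrier ?P" using x by simp
  have cl: "prod_idem I A \<in> I \<rightarrow> carrier ?P" using prod_idem_closed by simp
  have cl': "(\<lambda>i. prod_idem I A i \<otimes>\<^bsub>?P\<^esub> x) \<in> I \<rightarrow> carrier ?P"
    using cl x' by (auto simp del: underlying_ring_carrier)
  have "x = (\<Oplus>\<^bsub>?P\<^esub>i\<in>I. prod_idem I A i) \<otimes>\<^bsub>?P\<^esub> x"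
    unfolding sum_prod_idem[OF I] using R.l_one[OF x'] by simp
  also have "\<dots> = (\<Oplus>\<^bsub>?P\<^esub>i\<in>I. prod_idem I A i \<otimes>\<^bsub>?P\<^esub> x)"
    by (rule R.finsum_ldistr[OF I x' cl])
  finally have "g x = (\<Oplus>\<^bsub>?R\<^esub>i\<in>I. (g \<circ> (\<lambda>i. prod_idem I A i \<otimes>\<^bsub>?P\<^esub> x)) i)"
    using hom_finsum[OF cl'] by simp
  also have "\<dots> = (\<Oplus>\<^bsub>?R\<^esub>i\<in>I. g (axis_elem I A i (x i)))"
  proof (rule S.finsum_cong')
    fix i assume i: "i \<in> I"
    then show "(g \<circ> (\<lambda>i. prod_idem I A i \<otimes>\<^bsub>?P\<^esub> x)) i = g (axis_elem I A i (x i))"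
      by (simp add: prod_idem_mult[OF i x])
  next
    have "axis_elem I A i (x i) \<in> carrier (cinf_prod I A)" if "i \<in> I" for i
      using x that by (intro axis_elem_closed) auto
    then show "(\<lambda>i. g (axis_elem I A i (x i))) \<in> I \<rightarrow> carrier ?R"
      using g_closed by auto
  qed simp
  finally show ?thesis .
qed

text \<open>
  For the converse, call the sum \<open>g\<close>. Orthogonality gives \<open>\<epsilon>\<^sub>i g(x) = h\<^sub>i(x\<^sub>i)\<close>, so \<open>g\<close> respects every
  operation after multiplication with any \<open>\<epsilon>\<^sub>i\<close>, by the congruence at an idempotent. Since the \<open>\<epsilon>\<^sub>i\<close> sum
  to 1, it respects the operation itself.
\<close>

lemma sum_of_corner_homs:
  assumes I: "finite I" and B: "cinf_ring B"
    and \<epsilon>: "\<And>i. i \<in> I \<Longrightarrow> \<epsilon> i \<in> carrier B"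
    and orth: "\<And>i k. i \<in> I \<Longrightarrow> k \<in> I \<Longrightarrow> \<epsilon> i \<otimes>\<^bsub>underlying_ring B\<^esub> \<epsilon> k
        = (if i = k then \<epsilon> i else \<zero>\<^bsub>underlying_ring B\<^esub>)"
    and one: "(\<Oplus>\<^bsub>underlying_ring B\<^esub>i\<in>I. \<epsilon> i) = \<one>\<^bsub>underlying_ring B\<^esub>"
    and h: "\<And>i. i \<in> I \<Longrightarrow> h i \<in> cinf_hom (A i) (corner B (\<epsilon> i))"
  shows "(\<lambda>x\<in>carrier (cinf_prod I A). \<Oplus>\<^bsub>underlying_ring B\<^esub>i\<in>I. h i (x i)) \<in> cinf_hom (cinf_prod I A) B"
    (is "?g \<in> _")
proof -
  let ?P = "cinf_prod I A" and ?R = "underlying_ring B"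
  interpret cring ?R by (rule underlying_cring[OF B])
  have \<epsilon>': "\<epsilon> \<in> I \<rightarrow> carrier ?R" using \<epsilon> by simp
  have h_closed: "h i (x i) \<in> carrier ?R" "\<epsilon> i \<otimes>\<^bsub>?R\<^esub> h i (x i) = h i (x i)"
    if "i \<in> I" "x \<in> carrier ?P" for i x
  proof -
    have "x i \<in> carrier (A i)" using that by auto
    from hom_closed[OF h[OF that(1)] this]
    show "h i (x i) \<in> carrier ?R" "\<epsilon> i \<otimes>\<^bsub>?R\<^esub> h i (x i) = h i (x i)" by (simp_all add: corner_def)
  qed
  define g where "g = (\<lambda>x\<in>carrier ?P. \<Oplus>\<^bsub>?R\<^esub>i\<in>I. h i (x i))"
  have g_eq: "g x = (\<Oplus>\<^bsub>?R\<^esub>i\<in>I. h i (x i))" if "x \<in> carrier ?P" for x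
    unfolding g_def using that by (simp only: restrict_apply if_True)
  have g_closed: "g x \<in> carrier ?R" if "x \<in> carrier ?P" for x
  proof -
    have "(\<lambda>i. h i (x i)) \<in> I \<rightarrow> carrier ?R" using h_closed(1)[OF _ that] by blast
    from finsum_closed[OF this] show ?thesis unfolding g_eq[OF that] .
  qed
  have comp: "\<epsilon> k \<otimes>\<^bsub>?R\<^esub> g x = h k (x k)" if k: "k \<in> I" and x: "x \<in> carrier ?P" for k x
  proof -
    have hx: "(\<lambda>i. h i (x i)) \<in> I \<rightarrow> carrier ?R" using h_closed(1)[OF _ x] by blast
    have "\<epsilon> k \<otimes>\<^bsub>?R\<^esub> g x = (\<Oplus>\<^bsub>?R\<^esub>i\<in>I. \<epsilon> k \<otimes>\<^bsub>?R\<^esub> h i (x i))"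
      unfolding g_eq[OF x] using finsum_rdistr[OF I _ hx, of "\<epsilon> k"] \<epsilon>[OF k] by simp
    also have "\<dots> = (\<Oplus>\<^bsub>?R\<^esub>i\<in>I. if k = i then h i (x i) else \<zero>\<^bsub>?R\<^esub>)"
    proof (rule finsum_cong')
      fix i assume i: "i \<in> I"
      have "\<epsilon> k \<otimes>\<^bsub>?R\<^esub> h i (x i) = (\<epsilon> k \<otimes>\<^bsub>?R\<^esub> \<epsilon> i) \<otimes>\<^bsub>?R\<^esub> h i (x i)"
        using m_assoc[of "\<epsilon> k" "\<epsilon> i" "h i (x i)"] \<epsilon> i k h_closed[OF i x] by simp
      then show "\<epsilon> k \<otimes>\<^bsub>?R\<^esub> h i (x i) = (if k = i then h i (x i) else \<zero>\<^bsub>?R\<^esub>)"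
        using orth[OF k i] h_closed[OF i x] l_null by auto
    qed (use hx zero_closed in \<open>auto simp del: underlying_ring_carrier\<close>)
    also have "\<dots> = h k (x k)" by (rule finsum_singleton[OF k I hx])
    finally show ?thesis .
  qed
  have "g (opn ?P n f a) = opn B n f (\<lambda>j\<in>{..<n}. g (a j))"
    if f: "f \<in> smooth n" and a: "a \<in> tuples ?P n" for n f a
  proof -
    have aj: "a j \<in> carrier ?P" if "j < n" for j using a that unfolding tuples_def by blast
    have ga: "(\<lambda>j\<in>{..<n}. g (a j)) \<in> tuples B n"
      using g_closed[OF aj] by (auto simp: tuples_def)
    have o: "opn B n f (\<lambda>j\<in>{..<n}. g (a j)) \<in> carrier ?R"
      using cinf_ring_closed[OF B f ga] by simp
    have pointwise: "h i (opn ?P n f a i) = \<epsilon> i \<otimes>\<^bsub>?R\<^esub> opn B n f (\<lambda>j\<in>{..<n}. g (a j))"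
      if i: "i \<in> I" for i
    proof -
      note ai = prod_tuples_component[OF a i]
      have idem: "\<epsilon> i \<otimes>\<^bsub>?R\<^esub> \<epsilon> i = \<epsilon> i" using orth[OF i i] by simp
      have "h i (opn ?P n f a i) = h i (opn (A i) n f (\<lambda>j\<in>{..<n}. a j i))"
        using i by (simp only: prod_opn restrict_apply if_True)
      also have "\<dots> = \<epsilon> i \<otimes>\<^bsub>?R\<^esub> opn B n f (\<lambda>j\<in>{..<n}. h i ((\<lambda>j\<in>{..<n}. a j i) j))"
        unfolding hom_opn[OF h[OF i] f ai] by (simp add: corner_def)
      also have "\<dots> = \<epsilon> i \<otimes>\<^bsub>?R\<^esub> opn B n f (\<lambda>j\<in>{..<n}. g (a j))"
      proof (rule opn_cong_at_idempotent[OF B \<epsilon>[OF i] idem f _ ga])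
        show "(\<lambda>j\<in>{..<n}. h i ((\<lambda>j\<in>{..<n}. a j i) j)) \<in> tuples B n"
          using h_closed(1)[OF i aj] by (auto simp: tuples_def simp del: prod_carrier)
        fix j assume j: "j < n"
        show "\<epsilon> i \<otimes>\<^bsub>?R\<^esub> (\<lambda>j\<in>{..<n}. h i ((\<lambda>j\<in>{..<n}. a j i) j)) j = \<epsilon> i \<otimes>\<^bsub>?R\<^esub> (\<lambda>j\<in>{..<n}. g (a j)) j"
          using j comp[OF i aj[OF j]] h_closed(2)[OF i aj[OF j]] by (simp del: prod_carrier)
      qed
      finally show ?thesis .
    qed
    have "g (opn ?P n f a) = (\<Oplus>\<^bsub>?R\<^esub>i\<in>I. h i (opn ?P n f a i))"
      by (rule g_eq[OF cinf_ring_closed[OF prod_ring f a]])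
    also have "\<dots> = (\<Oplus>\<^bsub>?R\<^esub>i\<in>I. \<epsilon> i \<otimes>\<^bsub>?R\<^esub> opn B n f (\<lambda>j\<in>{..<n}. g (a j)))"
    proof (rule finsum_cong'[OF HOL.refl _ pointwise])
      show "(\<lambda>i. \<epsilon> i \<otimes>\<^bsub>?R\<^esub> opn B n f (\<lambda>j\<in>{..<n}. g (a j))) \<in> I \<rightarrow> carrier ?R"
        by (rule Pi_I, rule m_closed[OF _ o]) (simp add: \<epsilon>)
    qed
    also have "\<dots> = (\<Oplus>\<^bsub>?R\<^esub>i\<in>I. \<epsilon> i) \<otimes>\<^bsub>?R\<^esub> opn B n f (\<lambda>j\<in>{..<n}. g (a j))"
      by (rule finsum_ldistr[OF I o \<epsilon>', symmetric])
    also have "\<dots> = opn B n f (\<lambda>j\<in>{..<n}. g (a j))"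
      unfolding one by (rule l_one[OF o])
    finally show ?thesis .
  qed
  moreover have "g \<in> carrier ?P \<rightarrow>\<^sub>E carrier B"
    using g_closed by (auto simp: g_def simp del: prod_carrier)
  ultimately have "g \<in> cinf_hom ?P B" unfolding cinf_hom_def by blast
  then show ?thesis unfolding g_def .
qed

end

section \<open>The hull of a finite product\<close>

lemma prod_map_axis_elem:
  assumes A: "\<And>i. i \<in> I \<Longrightarrow> cinf_ring (A i)" and u: "\<And>i. i \<in> I \<Longrightarrow> u i \<in> cinf_hom (A i) (V i)"
    and c: "c \<in> carrier (A i)"
  shows "prod_map I A u (axis_elem I A i c) = axis_elem I V i (u i c)"
proof -
  have "axis_elem I A i c \<in> carrier (cinf_prod I A)"
    using A c by (rule axis_elem_closed)
  then show ?thesis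
    using hom_zero[OF u] by (auto simp: prod_map_def axis_elem_def fun_eq_iff)
qed

text \<open>
  A homomorphism \<open>f\<close> from the product to a regular \<open>B\<close> restricts to homomorphisms from the factors to
  corners of \<open>B\<close>. The corners are regular, so each restriction extends uniquely to the hull of its
  factor; the sum of these extensions is the required map. An arbitrary extension of \<open>f\<close> restricts to
  the factors in the same way, over the same idempotents of \<open>B\<close>, because the product of the units sends
  the idempotents of one product to those of the other. Hence it agrees with the sum.
\<close>

theorem prod_of_hulls_is_hull:
  fixes A :: "'i \<Rightarrow> 'a cinf" and V :: "'i \<Rightarrow> 'v cinf"
  assumes I: "finite I" and A: "\<And>i. i \<in> I \<Longrightarrow> cinf_ring (A i)"
    and V: "\<And>i. i \<in> I \<Longrightarrow> is_vn_hull TYPE('d) (A i) (V i) (u i)"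
  shows "is_vn_hull TYPE('d) (cinf_prod I A) (cinf_prod I V) (prod_map I A u)"
proof -
  let ?P = "cinf_prod I A" and ?Q = "cinf_prod I V" and ?\<eta> = "prod_map I A u"
  have rV: "\<And>i. i \<in> I \<Longrightarrow> vn_regular_cinf_ring (V i)"
    and u: "\<And>i. i \<in> I \<Longrightarrow> u i \<in> cinf_hom (A i) (V i)"
    using V by (auto simp: is_vn_hull_def)
  have cV: "\<And>i. i \<in> I \<Longrightarrow> cinf_ring (V i)" using rV by (simp add: vn_regular_cinf_ring_def)
  have cP: "cinf_ring ?P" using A by (rule cinf_ring_prod)
  have \<eta>: "?\<eta> \<in> cinf_hom ?P ?Q" using A u by (rule prod_map_hom)
  have \<eta>_axis: "?\<eta> (axis_elem I A i c) = axis_elem I V i (u i c)" if "c \<in> carrier (A i)" for i c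
    using A u that by (rule prod_map_axis_elem)
  have axis: "axis_elem I A i c \<in> carrier ?P" if "c \<in> carrier (A i)" for i c
    using A that by (rule axis_elem_closed)
  have idem: "prod_idem I A i \<in> carrier ?P" if "i \<in> I" for i
    using A that by (rule prod_idem_closed)
  have \<eta>_idem: "?\<eta> (prod_idem I A i) = prod_idem I V i" if i: "i \<in> I" for i
    using \<eta>_axis[of "\<one>\<^bsub>underlying_ring (A i)\<^esub>" i] factor_one_closed[of I A, OF A i] hom_one[OF u[OF i]]
    by (simp add: prod_idem_def)
  show ?thesis
    unfolding is_vn_hull_def
  proof (intro conjI allI impI ballI)
    show "vn_regular_cinf_ring ?Q" using rV by (rule vn_regular_prod)
    show "?\<eta> \<in> cinf_hom ?P ?Q" by (rule \<eta>)
    fix B :: "'d cinf" and f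
    assume B: "vn_regular_cinf_ring B" and f: "f \<in> cinf_hom ?P B"
    have cB: "cinf_ring B" using B by (simp add: vn_regular_cinf_ring_def)
    let ?R = "underlying_ring B" and ?RP = "underlying_ring ?P"
    define \<epsilon> where "\<epsilon> i = f (prod_idem I A i)" for i
    have \<epsilon>: "\<epsilon> i \<in> carrier B" if "i \<in> I" for i
      unfolding \<epsilon>_def using hom_closed[OF f idem[OF that]] .
    have orth: "\<epsilon> i \<otimes>\<^bsub>?R\<^esub> \<epsilon> k = (if i = k then \<epsilon> i else \<zero>\<^bsub>?R\<^esub>)" if "i \<in> I" "k \<in> I" for i k
      using hom_mult[OF f idem[OF that(1)] idem[OF that(2)]] prod_idem_orthogonal[of I A, OF A that] hom_zero[OF f]
      by (auto simp: \<epsilon>_def)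
    have one: "(\<Oplus>\<^bsub>?R\<^esub>i\<in>I. \<epsilon> i) = \<one>\<^bsub>?R\<^esub>"
    proof -
      interpret ring_hom_cring ?RP ?R f by (rule hom_ring_hom_cring[OF cP cB f])
      have "prod_idem I A \<in> I \<rightarrow> carrier ?RP" using idem by simp
      from hom_finsum[OF this] show ?thesis
        using sum_prod_idem[of I A, OF A I] by (simp add: \<epsilon>_def comp_def)
    qed
    define f' where "f' i = (\<lambda>c\<in>carrier (A i). f (axis_elem I A i c))" for i
    have rC: "vn_regular_cinf_ring (corner B (\<epsilon> i))" if "i \<in> I" for i
      using vn_regular_corner[OF B \<epsilon>[OF that]] orth[OF that that] by simp
    have f': "f' i \<in> cinf_hom (A i) (corner B (\<epsilon> i))" if "i \<in> I" for i
      unfolding f'_def \<epsilon>_def using A f that by (rule hom_axis_corner)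
    have "\<forall>i\<in>I. \<exists>g. g \<in> cinf_hom (V i) (corner B (\<epsilon> i)) \<and> compose (carrier (A i)) g (u i) = f' i"
      using V rC f' unfolding is_vn_hull_def by blast
    then obtain h where h: "\<And>i. i \<in> I \<Longrightarrow> h i \<in> cinf_hom (V i) (corner B (\<epsilon> i))"
      and hu: "\<And>i. i \<in> I \<Longrightarrow> compose (carrier (A i)) (h i) (u i) = f' i"
      by metis
    have h_unique: "k = h i" if "i \<in> I" "k \<in> cinf_hom (V i) (corner B (\<epsilon> i))"
        "compose (carrier (A i)) k (u i) = f' i" for i k
      using V[OF that(1)] rC[OF that(1)] f'[OF that(1)] h[OF that(1)] hu[OF that(1)] that(2,3)
      unfolding is_vn_hull_def by blast
    define g where "g = (\<lambda>y\<in>carrier ?Q. \<Oplus>\<^bsub>?R\<^esub>i\<in>I. h i (y i))"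
    have g: "g \<in> cinf_hom ?Q B"
      unfolding g_def using cV I cB \<epsilon> orth one h by (rule sum_of_corner_homs)
    have g_eq: "g y = (\<Oplus>\<^bsub>?R\<^esub>i\<in>I. h i (y i))" if "y \<in> carrier ?Q" for y
      unfolding g_def using that by (simp only: restrict_apply if_True)
    interpret cring ?R by (rule underlying_cring[OF cB])
    show "\<exists>!g. g \<in> cinf_hom ?Q B \<and> compose (carrier ?P) g ?\<eta> = f"
    proof (rule ex1I)
      have "compose (carrier ?P) g ?\<eta> x = f x" for x
      proof (cases "x \<in> carrier ?P")
        case True
        have xi: "x i \<in> carrier (A i)" if "i \<in> I" for i using True that by auto
        have "compose (carrier ?P) g ?\<eta> x = (\<Oplus>\<^bsub>?R\<^esub>i\<in>I. h i (?\<eta> x i))"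
          using True g_eq[OF hom_closed[OF \<eta> True]] by (simp only: compose_def restrict_apply if_True)
        also have "\<dots> = (\<Oplus>\<^bsub>?R\<^esub>i\<in>I. f (axis_elem I A i (x i)))"
        proof (rule finsum_cong')
          show "(\<lambda>i. f (axis_elem I A i (x i))) \<in> I \<rightarrow> carrier ?R"
            using hom_closed[OF f axis[OF xi]] by simp
          fix i assume i: "i \<in> I"
          have "?\<eta> x i = u i (x i)" using True i by (simp add: prod_map_def)
          then show "h i (?\<eta> x i) = f (axis_elem I A i (x i))"
            using fun_cong[OF hu[OF i], of "x i"] xi[OF i] by (simp add: compose_def f'_def)
        qed (rule HOL.refl)
        also have "\<dots> = f x"
          using hom_eq_sum_axis[of I A, OF A I cB f True] by simp
        finally show ?thesis .
      next
        case False
        then show ?thesis using f by (auto simp: compose_def cinf_hom_def PiE_def extensional_def)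
      qed
      then show "g \<in> cinf_hom ?Q B \<and> compose (carrier ?P) g ?\<eta> = f" using g by blast
    next
      fix k assume "k \<in> cinf_hom ?Q B \<and> compose (carrier ?P) k ?\<eta> = f"
      then have k: "k \<in> cinf_hom ?Q B" and k\<eta>': "compose (carrier ?P) k ?\<eta> = f"
        by blast+
      have k\<eta>: "k (?\<eta> x) = f x" if "x \<in> carrier ?P" for x
        using fun_cong[OF k\<eta>', of x] that by (simp only: compose_def restrict_apply if_True)
      have k_axis: "(\<lambda>y\<in>carrier (V i). k (axis_elem I V i y)) = h i" if i: "i \<in> I" for i
      proof (rule h_unique[OF i])
        have "k (prod_idem I V i) = \<epsilon> i"
          using k\<eta>[OF idem[OF i]] \<eta>_idem[OF i] by (simp add: \<epsilon>_def)
        then show "(\<lambda>y\<in>carrier (V i). k (axis_elem I V i y)) \<in> cinf_hom (V i) (corner B (\<epsilon> i))"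
          using hom_axis_corner[of I V, OF cV k i] by simp
        have "k (axis_elem I V i (u i c)) = f (axis_elem I A i c)" if "c \<in> carrier (A i)" for c
          using k\<eta>[OF axis[OF that]] \<eta>_axis[OF that] by simp
        then show "compose (carrier (A i)) (\<lambda>y\<in>carrier (V i). k (axis_elem I V i y)) (u i) = f' i"
          unfolding compose_def f'_def using hom_closed[OF u[OF i]] by (intro restrict_ext) simp
      qed
      have "k y = g y" if y: "y \<in> carrier ?Q" for y
      proof -
        have yi: "y i \<in> carrier (V i)" if "i \<in> I" for i using y that by auto
        have "k y = (\<Oplus>\<^bsub>?R\<^esub>i\<in>I. k (axis_elem I V i (y i)))"
          using cV I cB k y by (rule hom_eq_sum_axis)
        also have "\<dots> = (\<Oplus>\<^bsub>?R\<^esub>i\<in>I. h i (y i))"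
        proof (rule finsum_cong')
          show "(\<lambda>i. h i (y i)) \<in> I \<rightarrow> carrier ?R"
            using hom_closed[OF h yi] by (auto simp: corner_def)
          fix i assume i: "i \<in> I"
          show "k (axis_elem I V i (y i)) = h i (y i)"
            using fun_cong[OF k_axis[OF i], of "y i"] yi[OF i] by simp
        qed (rule HOL.refl)
        finally show ?thesis by (simp only: g_eq[OF y])
      qed
      moreover have "k \<in> carrier ?Q \<rightarrow>\<^sub>E carrier B" "g \<in> carrier ?Q \<rightarrow>\<^sub>E carrier B"
        using k g unfolding cinf_hom_def by blast+
      ultimately show "k = g" by (intro PiE_ext[of k "carrier ?Q" _ g])
    qed
  qed
qed

section \<open>The comparison isomorphism\<close>

lemma vn_lift:
  fixes B :: "'d cinf"
  assumes "is_vn_hull TYPE('d) A V \<eta>" "vn_regular_cinf_ring B" "f \<in> cinf_hom A B"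
  shows "vn_lift A V \<eta> B f \<in> cinf_hom V B" "compose (carrier A) (vn_lift A V \<eta> B f) \<eta> = f"
proof -
  have "\<exists>!g. g \<in> cinf_hom V B \<and> compose (carrier A) g \<eta> = f"
    using assms unfolding is_vn_hull_def by blast
  from theI'[OF this] show "vn_lift A V \<eta> B f \<in> cinf_hom V B"
    "compose (carrier A) (vn_lift A V \<eta> B f) \<eta> = f"
    unfolding vn_lift_def by blast+
qed

lemma hom_id_compose: "g \<in> cinf_hom B C \<Longrightarrow> compose (carrier B) (\<lambda>x\<in>carrier C. x) g = g"
  by (auto simp: cinf_hom_def PiE_def intro: Id_compose)

lemma hull_endomorphism_id:
  fixes V :: "'v cinf"
  assumes V: "is_vn_hull TYPE('v) A V \<eta>" and k: "k \<in> cinf_hom V V" "compose (carrier A) k \<eta> = \<eta>"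
  shows "k = (\<lambda>x\<in>carrier V. x)"
proof -
  have rV: "vn_regular_cinf_ring V" and \<eta>: "\<eta> \<in> cinf_hom A V"
    using V by (auto simp: is_vn_hull_def)
  have "compose (carrier A) (\<lambda>x\<in>carrier V. x) \<eta> = \<eta>"
    by (rule hom_id_compose[OF \<eta>])
  moreover have "(\<lambda>x\<in>carrier V. x) \<in> cinf_hom V V"
    using rV by (intro hom_id) (simp add: vn_regular_cinf_ring_def)
  ultimately show ?thesis
    using V rV \<eta> k unfolding is_vn_hull_def by blast
qed

theorem proposition10:
  fixes I :: "'i set" and A :: "'i \<Rightarrow> 'a cinf"
  assumes "finite I"
    and "\<And>i. i \<in> I \<Longrightarrow> cinf_ring (A i)"
  shows
    "let P = cinf_prod I A;
         Q = cinf_prod I (\<lambda>i. vN (A i));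
         \<eta> = prod_map I A (\<lambda>i. vn_unit (A i));
         \<pi> = cinf_proj I A;
         \<phi> = tupling I (vN P) (\<lambda>j. vN_map P (A j) (\<pi> j));
         \<psi> = vn_lift P Q \<eta> (vN P) (vn_unit P)
     in is_cinf_product TYPE('e) I (\<lambda>i. vN (A i)) (vN P) (\<lambda>j. vN_map P (A j) (\<pi> j)) \<and>
        is_vn_hull TYPE('d) P Q \<eta> \<and>
        \<phi> \<in> cinf_hom (vN P) Q \<and>
        \<psi> \<in> cinf_hom Q (vN P) \<and>
        compose (carrier (vN P)) \<psi> \<phi> = (\<lambda>x\<in>carrier (vN P). x) \<and>
        compose (carrier Q) \<phi> \<psi> = (\<lambda>y\<in>carrier Q. y) \<and>
        compose (carrier P) \<phi> (vn_unit P) = \<eta> \<and>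
        compose (carrier P) \<psi> \<eta> = vn_unit P"
proof -
  define P where "P = cinf_prod I A"
  define Q where "Q = cinf_prod I (\<lambda>i. vN (A i))"
  define \<eta> where "\<eta> = prod_map I A (\<lambda>i. vn_unit (A i))"
  define p where "p j = vN_map P (A j) (cinf_proj I A j)" for j
  define \<phi> where "\<phi> = tupling I (vN P) p"
  define \<psi> where "\<psi> = vn_lift P Q \<eta> (vN P) (vn_unit P)"
  note A = assms(2)
  have cP: "cinf_ring P" unfolding P_def using A by (rule cinf_ring_prod)
  \<comment> \<open>The universal property is used for three types of test objects: the arbitrary one of the
    claim, that of \<open>vN P\<close> to define \<open>\<psi>\<close>, and that of \<open>Q\<close> itself to recognize the identity.\<close>
  have hull_Q: "is_vn_hull TYPE('d) P Q \<eta>"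
    and hull_Q': "is_vn_hull TYPE(('i \<Rightarrow> 'a) vn_term set) P Q \<eta>"
    and hull_Q'': "is_vn_hull TYPE('i \<Rightarrow> 'a vn_term set) P Q \<eta>"
    unfolding P_def Q_def \<eta>_def by (rule prod_of_hulls_is_hull[OF assms vn_hull[OF A]]; assumption)+
  have hull_P: "is_vn_hull TYPE(('i \<Rightarrow> 'a) vn_term set) P (vN P) (vn_unit P)"
    and hull_P': "is_vn_hull TYPE('a vn_term set) P (vN P) (vn_unit P)"
    by (rule vn_hull[OF cP])+
  have rP: "vn_regular_cinf_ring (vN P)" and uP: "vn_unit P \<in> cinf_hom P (vN P)"
    using hull_P by (auto simp: is_vn_hull_def)
  have cvP: "cinf_ring (vN P)" using rP by (simp add: vn_regular_cinf_ring_def)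
  have \<eta>: "\<eta> \<in> cinf_hom P Q" and cQ: "cinf_ring Q"
    using hull_Q by (auto simp: is_vn_hull_def vn_regular_cinf_ring_def)
  have p: "p j \<in> cinf_hom (vN P) (vN (A j))"
    and pu: "compose (carrier P) (p j) (vn_unit P) = compose (carrier P) (vn_unit (A j)) (cinf_proj I A j)"
    if j: "j \<in> I" for j
  proof -
    have hj: "is_vn_hull TYPE('a) (A j) (vN (A j)) (vn_unit (A j))"
      by (rule vn_hull[OF A[OF j]])
    have \<pi>: "cinf_proj I A j \<in> cinf_hom P (A j)"
      unfolding P_def using A j by (rule proj_hom)
    have f: "compose (carrier P) (vn_unit (A j)) (cinf_proj I A j) \<in> cinf_hom P (vN (A j))"
      using hj by (intro hom_compose[OF cP \<pi>]) (simp add: is_vn_hull_def)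
    have r: "vn_regular_cinf_ring (vN (A j))" using hj by (simp add: is_vn_hull_def)
    show "p j \<in> cinf_hom (vN P) (vN (A j))"
      "compose (carrier P) (p j) (vn_unit P) = compose (carrier P) (vn_unit (A j)) (cinf_proj I A j)"
      unfolding p_def vN_map_def by (rule vn_lift[OF hull_P' r f])+
  qed
  have \<phi>: "\<phi> \<in> cinf_hom (vN P) Q"
    unfolding \<phi>_def Q_def using cvP p by (rule tupling_hom)
  have proj_\<phi>: "compose (carrier (vN P)) (cinf_proj I (\<lambda>i. vN (A i)) j) \<phi> = p j" if "j \<in> I" for j
    unfolding \<phi>_def using p that by (rule proj_tupling)
  have \<psi>: "\<psi> \<in> cinf_hom Q (vN P)" and \<psi>\<eta>: "compose (carrier P) \<psi> \<eta> = vn_unit P"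
    unfolding \<psi>_def by (rule vn_lift[OF hull_Q' rP uP])+
  have \<phi>u: "compose (carrier P) \<phi> (vn_unit P) = \<eta>"
  proof -
    have "\<phi> (vn_unit P x) = (\<lambda>i\<in>I. vn_unit (A i) (x i))" if x: "x \<in> carrier P" for x
    proof -
      have "p i (vn_unit P x) = vn_unit (A i) (x i)" if "i \<in> I" for i
        using fun_cong[OF pu[OF that], of x] x by (simp add: compose_def cinf_proj_def P_def)
      then show ?thesis
        using hom_closed[OF uP x] by (simp add: \<phi>_def tupling_def cong: restrict_cong)
    qed
    then show ?thesis
      unfolding \<eta>_def prod_map_def compose_def P_def[symmetric] by (intro restrict_ext)
  qed
  \<comment> \<open>Both composites fix the unit of a hull, so they are identities.\<close>
  have \<psi>\<phi>: "compose (carrier (vN P)) \<psi> \<phi> = (\<lambda>x\<in>carrier (vN P). x)"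
    by (rule hull_endomorphism_id[OF hull_P])
      (simp_all add: hom_compose[OF cvP \<phi> \<psi>] hom_compose_assoc[OF uP] \<phi>u \<psi>\<eta>)
  have \<phi>\<psi>: "compose (carrier Q) \<phi> \<psi> = (\<lambda>y\<in>carrier Q. y)"
    by (rule hull_endomorphism_id[OF hull_Q''])
      (simp_all add: hom_compose[OF cQ \<psi> \<phi>] hom_compose_assoc[OF \<eta>] \<phi>u \<psi>\<eta>)
  \<comment> \<open>The maps \<open>p j\<close> are the projections of \<open>Q\<close> transported along the isomorphism \<open>\<phi>\<close>, so the
    product property of \<open>Q\<close> carries over to \<open>vN P\<close>.\<close>
  have "is_cinf_product TYPE('e) I (\<lambda>i. vN (A i)) (vN P) p"
    unfolding is_cinf_product_def
  proof (intro conjI allI impI ballI cvP p)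
    fix B :: "'e cinf" and h
    assume B: "cinf_ring B" and h: "\<forall>i\<in>I. h i \<in> cinf_hom B (vN (A i))"
    let ?t = "tupling I B h"
    have t: "?t \<in> cinf_hom B Q"
      unfolding Q_def using B h by (intro tupling_hom) auto
    show "\<exists>!g. g \<in> cinf_hom B (vN P) \<and> (\<forall>i\<in>I. compose (carrier B) (p i) g = h i)"
    proof (rule ex1I)
      let ?g = "compose (carrier B) \<psi> ?t"
      have g: "?g \<in> cinf_hom B (vN P)" by (rule hom_compose[OF B t \<psi>])
      have \<phi>g: "compose (carrier B) \<phi> ?g = ?t"
        by (simp add: hom_compose_assoc[OF t, symmetric] \<phi>\<psi> hom_id_compose[OF t])
      have "compose (carrier B) (p i) ?g = h i" if i: "i \<in> I" for i
      proof -
        have "compose (carrier B) (p i) ?g = compose (carrier B) (cinf_proj I (\<lambda>i. vN (A i)) i) ?t"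
          by (simp add: proj_\<phi>[OF i, symmetric] hom_compose_assoc[OF g] \<phi>g)
        also have "\<dots> = h i" using h i by (intro proj_tupling) auto
        finally show ?thesis .
      qed
      then show "?g \<in> cinf_hom B (vN P) \<and> (\<forall>i\<in>I. compose (carrier B) (p i) ?g = h i)"
        using g by blast
    next
      fix g assume "g \<in> cinf_hom B (vN P) \<and> (\<forall>i\<in>I. compose (carrier B) (p i) g = h i)"
      then have g: "g \<in> cinf_hom B (vN P)" and pg: "\<And>i. i \<in> I \<Longrightarrow> compose (carrier B) (p i) g = h i"
        by auto
      have "compose (carrier B) \<phi> g \<in> cinf_hom B (cinf_prod I (\<lambda>i. vN (A i)))"
        using hom_compose[OF B g \<phi>] by (simp add: Q_def)
      from tupling_proj[OF this] have "compose (carrier B) \<phi> g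
          = tupling I B (\<lambda>i. compose (carrier B) (cinf_proj I (\<lambda>i. vN (A i)) i) (compose (carrier B) \<phi> g))"
        by simp
      also have "\<dots> = ?t"
        unfolding tupling_def hom_compose_assoc[OF g, symmetric]
        by (intro restrict_ext) (simp add: proj_\<phi> pg)
      finally have "compose (carrier B) \<psi> (compose (carrier B) \<phi> g) = compose (carrier B) \<psi> ?t" by simp
      then show "g = compose (carrier B) \<psi> ?t"
        by (simp add: hom_compose_assoc[OF g, symmetric] \<psi>\<phi> hom_id_compose[OF g])
    qed
  qed
  then show ?thesis
    using hull_Q \<phi> \<psi> \<psi>\<phi> \<phi>\<psi> \<phi>u \<psi>\<eta>
    unfolding Let_def \<psi>_def \<phi>_def p_def \<eta>_def P_def Q_def by blast
qed

end
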